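(* Let $\mathbf u\in\mathbb Z_{>0}^n$, let $Q\in S$ be a nonzero $\mathbf u$-homogeneous polynomial, and let $\mathbf v\in\mathbb Z^n$ be such that $\mathbf u+\mathbf v=(k,\dots,k)$ for some $k\in\mathbb Z$. Then $D(Q)$ is a graded $S^{\mathbf u}$-submodule of $D^{(\mathbf u,\mathbf v)}$, i.e. the homogeneous components of every element of $D(Q)$ lie in $D(Q)$. Moreover, if $$0\longleftarrow D^{(\mathbf u,\mathbf v)}(Q)\longleftarrow \bigoplus_{i=1}^{r_0}S^{\mathbf u}(-d_i^0)\longleftarrow\cdots\longleftarrow\bigoplus_{i=1}^{r_\ell}S^{\mathbf u}(-d_i^\ell)\longleftarrow 0$$ is any exact sequence of graded $S^{\mathbf u}$-modules whose maps are homogeneous of degree $0$ (a finite homogeneous free resolution), then $$\deg^{\mathbf u}(Q)+|\mathbf v|=\sum_{p=0}^{\ell}(-1)^p\sum_{i=1}^{r_p}d_i^p .$$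
   Context: Let $\mathbb K$ be a field of characteristic zero, $S=\mathbb K[x_1,\dots,x_n]$, $\partial_i=\partial/\partial x_i$, and $D=\mathrm{Der}_{\mathbb K}(S)$, the free $S$-module with basis $\partial_1,\dots,\partial_n$. For $g\in S$ and an integer $e\ge1$ put $D(g;e)=\{\delta\in D:\ \delta(g)\in g^eS\}$. For a nonzero $f\in S$ with factorization $f=c\,f_1^{e_1}\cdots f_r^{e_r}$ ($c\in\mathbb K^*$, $f_i$ pairwise non-associate irreducibles), the (generalized) logarithmic derivation module is $D(f)=\bigcap_{i=1}^r D(f_i;e_i)$ (so $D(f)=D$ if $f$ is constant). For $\mathbf u=(u_1,\dots,u_n)\in\mathbb Z_{>0}^n$, $S^{\mathbf u}$ denotes $S$ graded so that $(S^{\mathbf u})_i$ is spanned by the monomials $x_1^{a_1}\cdots x_n^{a_n}$ with $\sum_j a_ju_j=i$; elements of $(S^{\mathbf u})_i$ are called $\mathbf u$-homogeneous (quasi-homogeneous) of degree $\deg^{\mathbf u}=i$. For $\mathbf v=(v_1,\dots,v_n)\in\mathbb Z^n$, $D^{(\mathbf u,\mathbf v)}$ denotes $D$ graded so that $a\partial_i$ has degree $\deg^{\mathbf u}(a)+v_i$ for $\mathbf u$-homogeneous $a$; thus $D^{(\mathbf u,\mathbf v)}\cong\bigoplus_i S^{\mathbf u}(-v_i)$. For a graded module $M$, $M(d)$ is the shifted module with $M(d)_i=M_{i+d}$. $|\mathbf v|=v_1+\cdots+v_n$. When $D(Q)$ is a graded submodule of $D^{(\mathbf u,\mathbf v)}$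 it is denoted $D^{(\mathbf u,\mathbf v)}(Q)$ with the induced grading. *)

theory Defs
  imports "HOL-Library.Poly_Mapping" "HOL-Computational_Algebra.Factorial_Ring"
begin

text \<open>Multivariate polynomials over 'a: finitely supported maps from monomials
(exponent vectors nat =>0 nat) to coefficients. The variables are x_0, ..., x_(n-1).\<close>
type_synonym 'a mpoly = "(nat \<Rightarrow>\<^sub>0 nat) \<Rightarrow>\<^sub>0 'a"

definition inS :: "nat \<Rightarrow> ('a::zero) mpoly \<Rightarrow> bool" where
  "inS n p \<longleftrightarrow> (\<forall>m\<in>Poly_Mapping.keys p. \<forall>j\<in>Poly_Mapping.keys m. j < n)"

definition pdiff :: "nat \<Rightarrow> ('a::comm_semiring_1) mpoly \<Rightarrow> 'a mpoly" where
  "pdiff i p = Abs_poly_mapping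
     (\<lambda>m. of_nat (Poly_Mapping.lookup m i + 1) * Poly_Mapping.lookup p (m + Poly_Mapping.single i 1))"

text \<open>A derivation delta = sum_(i<n) a_i d_i is represented by its coefficient
function a; it belongs to D = Der(S) if all a_i (i<n) lie in S.\<close>
definition derS :: "nat \<Rightarrow> (nat \<Rightarrow> ('a::zero) mpoly) \<Rightarrow> bool" where
  "derS n a \<longleftrightarrow> (\<forall>i<n. inS n (a i))"

definition apply_der :: "nat \<Rightarrow> (nat \<Rightarrow> ('a::comm_semiring_1) mpoly) \<Rightarrow> 'a mpoly \<Rightarrow> 'a mpoly" where
  "apply_der n a g = (\<Sum>i<n. a i * pdiff i g)"

definition Dlog :: "nat \<Rightarrow> ('a::comm_semiring_1) mpoly \<Rightarrow> (nat \<Rightarrow> 'a mpoly) set" where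
  "Dlog n f = {a. derS n a \<and>
     (\<forall>g e. inS n g \<longrightarrow> irreducible g \<longrightarrow> 1 \<le> e \<longrightarrow> g ^ e dvd f \<longrightarrow> \<not> g ^ (Suc e) dvd f
        \<longrightarrow> g ^ e dvd apply_der n a g)}"

definition wdeg :: "nat \<Rightarrow> (nat \<Rightarrow> int) \<Rightarrow> (nat \<Rightarrow>\<^sub>0 nat) \<Rightarrow> int" where
  "wdeg n u m = (\<Sum>j<n. u j * int (Poly_Mapping.lookup m j))"

text \<open>p is u-homogeneous of degree d (the zero polynomial is homogeneous of every degree).\<close>
definition uhom :: "nat \<Rightarrow> (nat \<Rightarrow> int) \<Rightarrow> int \<Rightarrow> ('a::zero) mpoly \<Rightarrow> bool" where
  "uhom n u d p \<longleftrightarrow> (\<forall>m\<in>Poly_Mapping.keys p. wdeg n u m = d)"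

definition hcomp :: "nat \<Rightarrow> (nat \<Rightarrow> int) \<Rightarrow> int \<Rightarrow> ('a::zero) mpoly \<Rightarrow> 'a mpoly" where
  "hcomp n u d p = Abs_poly_mapping (\<lambda>m. if wdeg n u m = d then Poly_Mapping.lookup p m else 0)"

text \<open>Homogeneous component of degree t of a derivation in D^(u,v):
a_i d_i has degree deg^u(a_i) + v_i.\<close>
definition hcompD :: "nat \<Rightarrow> (nat \<Rightarrow> int) \<Rightarrow> (nat \<Rightarrow> int) \<Rightarrow> int
    \<Rightarrow> (nat \<Rightarrow> ('a::zero) mpoly) \<Rightarrow> (nat \<Rightarrow> 'a mpoly)" where
  "hcompD n u v t a = (\<lambda>i. hcomp n u (t - v i) (a i))"

definition vecS :: "nat \<Rightarrow> nat \<Rightarrow> (nat \<Rightarrow> ('a::zero) mpoly) \<Rightarrow> bool" where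
  "vecS n r c \<longleftrightarrow> (\<forall>i<r. inS n (c i))"

definition mapply :: "(nat \<Rightarrow> nat \<Rightarrow> ('a::comm_semiring_1) mpoly) \<Rightarrow> nat \<Rightarrow> (nat \<Rightarrow> 'a mpoly) \<Rightarrow> nat \<Rightarrow> 'a mpoly" where
  "mapply M r c j = (\<Sum>i<r. M j i * c i)"

text \<open>Finite homogeneous free resolution of D^(u,v)(Q):
  0 <- D(Q) <-M_0- F_0 <-M_1- F_1 <- ... <-M_l- F_l <- 0,
with F_p = (+)_(i<r p) S^u(- d p i). A degree-0 graded map F_p -> F_(p-1) is a
matrix M_p whose (j,i) entry is u-homogeneous of degree d p i - d (p-1) j;
the map F_0 -> D^(u,v) is a matrix M_0 (rows indexed by the n partial derivatives)
whose (k,i) entry is u-homogeneous of degree d 0 i - v k, i.e. the image of the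
i-th basis vector is a homogeneous derivation of degree d 0 i.
tgt p is the rank of the target of M_p.\<close>
definition homog_free_resolution ::
  "nat \<Rightarrow> (nat \<Rightarrow> int) \<Rightarrow> (nat \<Rightarrow> int) \<Rightarrow> ('a::comm_semiring_1) mpoly \<Rightarrow> nat \<Rightarrow> (nat \<Rightarrow> nat)
    \<Rightarrow> (nat \<Rightarrow> nat \<Rightarrow> int) \<Rightarrow> (nat \<Rightarrow> nat \<Rightarrow> nat \<Rightarrow> 'a mpoly) \<Rightarrow> bool" where
  "homog_free_resolution n u v Q l r d M \<longleftrightarrow>
    (let tgt = (\<lambda>p. if p = 0 then n else r (p - 1)) in
     \<comment> \<open>entries lie in S and the maps are homogeneous of degree 0\<close>
     (\<forall>p\<le>l. \<forall>j<tgt p. \<forall>i<r p. inS n (M p j i) \<and>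
        uhom n u (d p i - (if p = 0 then v j else d (p - 1) j)) (M p j i)) \<and>
     \<comment> \<open>M_0 maps F_0 into D(Q)\<close>
     (\<forall>i<r 0. (\<lambda>k. M 0 k i) \<in> Dlog n Q) \<and>
     \<comment> \<open>M_0 maps onto D(Q)\<close>
     (\<forall>a\<in>Dlog n Q. \<exists>c. vecS n (r 0) c \<and> (\<forall>k<n. a k = mapply (M 0) (r 0) c k)) \<and>
     \<comment> \<open>exactness at F_p for p < l: image of M_(p+1) = kernel of M_p\<close>
     (\<forall>p<l. (\<forall>b. vecS n (r (Suc p)) b \<longrightarrow>
               (\<forall>j<tgt p. mapply (M p) (r p) (mapply (M (Suc p)) (r (Suc p)) b) j = 0)) \<and>
            (\<forall>c. vecS n (r p) c \<longrightarrow> (\<forall>j<tgt p. mapply (M p) (r p) c j = 0) \<longrightarrow>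
               (\<exists>b. vecS n (r (Suc p)) b \<and> (\<forall>i<r p. c i = mapply (M (Suc p)) (r (Suc p)) b i)))) \<and>
     \<comment> \<open>exactness at F_l: M_l is injective\<close>
     (\<forall>c. vecS n (r l) c \<longrightarrow> (\<forall>j<tgt l. mapply (M l) (r l) c j = 0) \<longrightarrow> (\<forall>i<r l. c i = 0)))"

end

theory Submission
  imports Defs "HOL-Analysis.Analysis" "HOL-Computational_Algebra.Polynomial" "HOL-Library.Function_Algebras"
begin

text \<open>
  Both sides of the degree formula are read off from the Hilbert series of \<open>D(Q)\<close>. Let \<open>Z(t)\<close> be the
  Hilbert series of \<open>S\<close>. A homogeneous resolution gives the series
  \<open>Z(t) * (\<Sum>p. (-1)^p * (\<Sum>i. t^(d p i)))\<close>, whose quotient by \<open>Z(t)\<close> has the alternating sum of the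
  \<open>d p i\<close> as derivative at 1.

  On the other hand, write \<open>Q = f^e * Q'\<close> with \<open>f\<close> irreducible of degree \<open>c\<close>, not dividing \<open>Q'\<close>. Then
  \<open>D(Q)\<close> is the kernel of \<open>D(Q') \<rightarrow> S/f^e\<close>, \<open>\<delta> \<mapsto> \<delta>(f)\<close>, which shifts degrees by \<open>c - k\<close>. Its image
  contains the multiples of \<open>h = Q' * \<partial>\<^sub>j f\<close>, and \<open>f\<close> is prime and does not divide \<open>h\<close> for a
  suitable \<open>j\<close>; so the cokernel is a quotient of \<open>S/(f^e, h)\<close>, whose series is
  \<open>(1 - t^(e*c)) * (1 - t^(deg h)) * Z(t)\<close>. This vanishes to second order at 1 relative to \<open>Z(t)\<close>, hence
  passing from \<open>Q'\<close> to \<open>Q\<close> raises the derivative by exactly \<open>e * c\<close>.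
\<close>

text \<open>The cokernel is only squeezed, never computed. Both bounds contribute difference
  quotients at 1 with the same limit, whatever the degree of \<open>h\<close> is. Limits for t -> 1
  from below are used because the series converge only for t < 1, and because their quotient is not
  known to be a Laurent polynomial before a resolution is given.

  Multiples of \<open>h\<close> are values at \<open>f\<close> of derivations in D(Q') because a
  derivation with coefficients divisible by Q' sends every polynomial to a multiple of Q'. A
  suitable j exists by characteristic zero; then the partial derivative has smaller degree than
  \<open>f\<close>, so \<open>f\<close> does not divide it. The condition that u + v is constant
  makes evaluation at \<open>f\<close> homogeneous.

  The syzygies of f^e and h are under control only if \<open>f\<close> is prime, so irreducible
  elements of S are shown to be prime by induction on the number of variables. \<open>Dlog\<close>
  is stated with divisibility in a ring with infinitely many variables; since divisors of nonzero
  elements of S lie in S (\<open>inS_dvd\<close>), this agrees with divisibility in S.\<close>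

abbreviation lookup :: "('a \<Rightarrow>\<^sub>0 'b::zero) \<Rightarrow> 'a \<Rightarrow> 'b" where
  "lookup \<equiv> Poly_Mapping.lookup"
abbreviation keys :: "('a \<Rightarrow>\<^sub>0 'b::zero) \<Rightarrow> 'a set" where
  "keys \<equiv> Poly_Mapping.keys"
abbreviation single :: "'a \<Rightarrow> 'b \<Rightarrow> 'a \<Rightarrow>\<^sub>0 'b::zero" where
  "single \<equiv> Poly_Mapping.single"

section \<open>Gradings of the polynomial ring\<close>

lemma wdeg_0 [simp]: "wdeg n u 0 = 0"
  by (simp add: wdeg_def)

lemma wdeg_add: "wdeg n u (m + m') = wdeg n u m + wdeg n u m'"
  by (simp add: wdeg_def lookup_add algebra_simps sum.distrib)

lemma wdeg_single: "i < n \<Longrightarrow> wdeg n u (single i c) = u i * int c"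
  by (simp add: wdeg_def lookup_single when_def if_distrib cong: if_cong)

lemma wdeg_uminus: "wdeg n (\<lambda>i. - u i) m = - wdeg n u m"
  by (simp add: wdeg_def sum_negf)

lemma wdeg_nonneg: "(\<And>i. i < n \<Longrightarrow> 0 \<le> u i) \<Longrightarrow> 0 \<le> wdeg n u m"
  unfolding wdeg_def by (intro sum_nonneg mult_nonneg_nonneg) auto

lemma lookup_hcomp: "lookup (hcomp n u d p) m = (if wdeg n u m = d then lookup p m else 0)"
proof -
  have "finite {m. (if wdeg n u m = d then lookup p m else 0) \<noteq> 0}"
    by (rule finite_subset[of _ "keys p"]) (auto simp: in_keys_iff split: if_splits)
  then show ?thesis unfolding hcomp_def by simp
qed

lemma lookup_pdiff:
  "lookup (pdiff i p) m = of_nat (lookup m i + 1) * lookup p (m + single i 1)"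
proof -
  have "{m. of_nat (lookup m i + 1) * lookup p (m + single i 1) \<noteq> 0}
          \<subseteq> (\<lambda>m. m + single i 1) -` keys p"
    by (auto simp: in_keys_iff)
  moreover have "finite ((\<lambda>m. m + single i 1) -` keys p)"
    by (intro finite_vimageI) (auto simp: inj_on_def)
  ultimately have "finite {m. of_nat (lookup m i + 1) * lookup p (m + single i 1) \<noteq> 0}"
    by (rule finite_subset)
  then show ?thesis unfolding pdiff_def by simp
qed

lemma in_keys_multE:
  assumes "m \<in> keys (p * q)"
  obtains a b where "a \<in> keys p" "b \<in> keys q" "m = a + b"
  using assms keys_mult[of p q] by blast

lemma inS_0 [simp]: "inS n 0" by (simp add: inS_def)
lemma inS_1 [simp]: "inS n (1 :: 'a::comm_semiring_1 mpoly)" by (simp add: inS_def)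

lemma inS_single: "inS n (single m c) \<longleftrightarrow> c = 0 \<or> (\<forall>j\<in>keys m. j < n)"
  by (simp add: inS_def)

lemma inS_add: "inS n p \<Longrightarrow> inS n q \<Longrightarrow> inS n (p + q)"
  using keys_add[of p q] unfolding inS_def by blast

lemma inS_uminus: "inS n p \<Longrightarrow> inS n (- p :: 'a::ab_group_add mpoly)"
  unfolding inS_def by (simp add: in_keys_iff)

lemma inS_diff: "inS n p \<Longrightarrow> inS n q \<Longrightarrow> inS n (p - q :: 'a::ab_group_add mpoly)"
  using inS_add[of n p "- q"] inS_uminus[of n q] by simp

lemma inS_mult:
  assumes "inS n p" "inS n (q :: 'a::comm_semiring_1 mpoly)"
  shows "inS n (p * q)"
  unfolding inS_def
proof (intro ballI)
  fix m j assume m: "m \<in> keys (p * q)" and j: "j \<in> keys m"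
  obtain a b where "a \<in> keys p" "b \<in> keys q" "m = a + b" using m by (rule in_keys_multE)
  then show "j < n" using assms j keys_add[of a b] unfolding inS_def by blast
qed

lemma inS_sum: "(\<And>i. i \<in> A \<Longrightarrow> inS n (f i)) \<Longrightarrow> inS n (sum f A)"
  by (induction A rule: infinite_finite_induct) (auto intro: inS_add)

lemma inS_power: "inS n p \<Longrightarrow> inS n (p ^ e :: 'a::comm_semiring_1 mpoly)"
  by (induction e) (auto intro: inS_mult)

lemma inS_hcomp: "inS n p \<Longrightarrow> inS n (hcomp n' u d p)"
  unfolding inS_def by (auto simp: in_keys_iff lookup_hcomp split: if_splits)

lemma inS_mono: "inS n p \<Longrightarrow> n \<le> n' \<Longrightarrow> inS n' p"
  unfolding inS_def by (meson order_less_le_trans)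

lemma inS_pdiff:
  assumes "inS n p" shows "inS n (pdiff i p)"
  unfolding inS_def
proof (intro ballI)
  fix m j assume "m \<in> keys (pdiff i p)" and j: "j \<in> keys m"
  then have "m + single i 1 \<in> keys p" by (auto simp: in_keys_iff lookup_pdiff)
  moreover have "j \<in> keys (m + single i 1)" using j by (simp add: in_keys_iff lookup_add)
  ultimately show "j < n" using assms unfolding inS_def by blast
qed

lemma uhom_0 [simp]: "uhom n u d 0" by (simp add: uhom_def)
lemma uhom_1: "uhom n u 0 (1 :: 'a::comm_semiring_1 mpoly)" by (simp add: uhom_def)

lemma uhom_add: "uhom n u d p \<Longrightarrow> uhom n u d q \<Longrightarrow> uhom n u d (p + q)"
  using keys_add[of p q] unfolding uhom_def by blast

lemma uhom_uminus: "uhom n u d p \<Longrightarrow> uhom n u d (- p :: 'a::ab_group_add mpoly)"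
  unfolding uhom_def by (simp add: in_keys_iff)

lemma uhom_mult:
  assumes "uhom n u d p" "uhom n u d' (q :: 'a::comm_semiring_1 mpoly)"
  shows "uhom n u (d + d') (p * q)"
  unfolding uhom_def
proof
  fix m assume "m \<in> keys (p * q)"
  then obtain a b where "a \<in> keys p" "b \<in> keys q" "m = a + b" by (rule in_keys_multE)
  then show "wdeg n u m = d + d'" using assms by (simp add: uhom_def wdeg_add)
qed

lemma uhom_sum: "(\<And>i. i \<in> A \<Longrightarrow> uhom n u d (f i)) \<Longrightarrow> uhom n u d (sum f A)"
  by (induction A rule: infinite_finite_induct) (auto intro: uhom_add)

lemma uhom_power: "uhom n u d p \<Longrightarrow> uhom n u (int e * d) (p ^ e :: 'a::comm_semiring_1 mpoly)"
  by (induction e) (auto simp: uhom_1 algebra_simps intro: uhom_mult)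

lemma uhom_hcomp: "uhom n u d (hcomp n u d p)"
  unfolding uhom_def by (auto simp: in_keys_iff lookup_hcomp split: if_splits)

lemma uhom_pdiff:
  assumes "uhom n u d p" "i < n"
  shows "uhom n u (d - u i) (pdiff i p)"
  unfolding uhom_def
proof
  fix m assume "m \<in> keys (pdiff i p)"
  then have "m + single i 1 \<in> keys p" by (auto simp: in_keys_iff lookup_pdiff)
  then have "wdeg n u (m + single i 1) = d" using assms by (simp add: uhom_def)
  then show "wdeg n u m = d - u i" using assms(2) by (simp add: wdeg_add wdeg_single)
qed

lemma uhom_unique: "p \<noteq> 0 \<Longrightarrow> uhom n u d p \<Longrightarrow> uhom n u d' p \<Longrightarrow> d = d'"
  unfolding uhom_def by (metis all_not_in_conv keys_eq_empty)

lemma hcomp_0 [simp]: "hcomp n u d 0 = 0"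
  by (rule poly_mapping_eqI) (simp add: lookup_hcomp)

lemma hcomp_add: "hcomp n u d (p + q) = hcomp n u d p + hcomp n u d q"
  by (rule poly_mapping_eqI) (simp add: lookup_hcomp lookup_add)

lemma hcomp_sum: "hcomp n u d (sum f A) = (\<Sum>i\<in>A. hcomp n u d (f i))"
  by (induction A rule: infinite_finite_induct) (auto simp: hcomp_add)

lemma hcomp_id: "uhom n u d p \<Longrightarrow> hcomp n u d p = p"
  by (rule poly_mapping_eqI) (auto simp: lookup_hcomp uhom_def in_keys_iff)

lemma hcomp_eq_0: "(\<And>m. m \<in> keys p \<Longrightarrow> wdeg n u m \<noteq> d) \<Longrightarrow> hcomp n u d p = 0"
  by (rule poly_mapping_eqI) (auto simp: lookup_hcomp in_keys_iff)

text \<open>Apart from its component of degree \<open>d - d'\<close>, \<open>p\<close> has no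
  monomial that multiplication by \<open>A\<close> could move into degree \<open>d\<close>.\<close>

lemma hcomp_mult:
  assumes "uhom n u d' (A :: 'a::comm_ring_1 mpoly)"
  shows "hcomp n u d (A * p) = A * hcomp n u (d - d') p"
proof -
  let ?p = "hcomp n u (d - d') p"
  have "hcomp n u d (A * (p - ?p)) = 0"
  proof (rule hcomp_eq_0)
    fix m assume "m \<in> keys (A * (p - ?p))"
    then obtain a b where ab: "a \<in> keys A" "b \<in> keys (p - ?p)" "m = a + b" by (rule in_keys_multE)
    from ab(2) have "wdeg n u b \<noteq> d - d'" by (auto simp: in_keys_iff lookup_minus lookup_hcomp)
    then show "wdeg n u m \<noteq> d" using ab assms by (auto simp: uhom_def wdeg_add)
  qed
  moreover have "hcomp n u d (A * ?p) = A * ?p"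
    using uhom_mult[OF assms uhom_hcomp[of n u "d - d'" p]] by (intro hcomp_id) simp
  moreover have "A * p = A * (p - ?p) + A * ?p" by (simp add: algebra_simps)
  ultimately show ?thesis by (metis hcomp_add add_0)
qed

section \<open>Top degrees and factors of homogeneous polynomials\<close>

definition wtop :: "nat \<Rightarrow> (nat \<Rightarrow> int) \<Rightarrow> 'a::zero mpoly \<Rightarrow> int" where
  "wtop n u p = Max (wdeg n u ` keys p)"

lemma wdeg_le_wtop: "m \<in> keys p \<Longrightarrow> wdeg n u m \<le> wtop n u p"
  unfolding wtop_def by simp

lemma wtop_attained:
  assumes "p \<noteq> 0" obtains m where "m \<in> keys p" "wdeg n u m = wtop n u p"
proof -
  have "wtop n u p \<in> wdeg n u ` keys p"
    unfolding wtop_def using assms by (intro Max_in) auto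
  then show ?thesis using that by auto
qed

lemma wtop_uhom: "p \<noteq> 0 \<Longrightarrow> uhom n u d p \<Longrightarrow> wtop n u p = d"
  by (metis uhom_def wtop_attained)

text \<open>The product of the two leading forms is nonzero because the ring is a domain, and every
  other contribution to the product has smaller degree. Zero is excluded since its
  \<open>wtop\<close> is the \<open>Max\<close> of an empty set.\<close>

lemma wtop_mult:
  fixes p q :: "'a::idom mpoly"
  assumes "p \<noteq> 0" "q \<noteq> 0"
  shows "wtop n u (p * q) = wtop n u p + wtop n u q"
proof -
  let ?a = "wtop n u p" and ?b = "wtop n u q"
  let ?p = "hcomp n u ?a p" and ?q = "hcomp n u ?b q"
  have nz: "hcomp n u (wtop n u r) r \<noteq> 0" if r: "r \<noteq> 0" for r :: "'a mpoly"
  proof -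
    obtain m where "m \<in> keys r" "wdeg n u m = wtop n u r" using r by (rule wtop_attained)
    then have "lookup (hcomp n u (wtop n u r) r) m \<noteq> 0" by (simp add: lookup_hcomp in_keys_iff)
    then show ?thesis by auto
  qed
  have "?p * ?q \<noteq> 0" using nz assms by simp
  then obtain m where m: "m \<in> keys (?p * ?q)" by (metis keys_eq_empty ex_in_conv)
  have wm: "wdeg n u m = ?a + ?b"
    using uhom_mult[OF uhom_hcomp uhom_hcomp] m unfolding uhom_def by blast
  have eq: "p * q = ?p * ?q + ((p - ?p) * q + ?p * (q - ?q))" by (simp add: algebra_simps)
  have low: "wdeg n u b < wtop n u r" if "b \<in> keys (r - hcomp n u (wtop n u r) r)"
    for b and r :: "'a mpoly"
  proof -
    have "wdeg n u b \<noteq> wtop n u r" "b \<in> keys r"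
      using that by (auto simp: in_keys_iff lookup_minus lookup_hcomp split: if_splits)
    then show ?thesis using wdeg_le_wtop[of b r n u] by simp
  qed
  have "m \<notin> keys ((p - ?p) * q)"
  proof
    assume "m \<in> keys ((p - ?p) * q)"
    then obtain a b where "a \<in> keys (p - ?p)" "b \<in> keys q" "m = a + b" by (rule in_keys_multE)
    then show False using low[of a p] wdeg_le_wtop[of b q n u] wm by (simp add: wdeg_add)
  qed
  moreover have "m \<notin> keys (?p * (q - ?q))"
  proof
    assume "m \<in> keys (?p * (q - ?q))"
    then obtain a b where ab: "a \<in> keys ?p" "b \<in> keys (q - ?q)" "m = a + b" by (rule in_keys_multE)
    from ab(1) have "wdeg n u a = ?a" using uhom_hcomp uhom_def by blast
    then show False using low[of b q] ab wm by (simp add: wdeg_add)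
  qed
  ultimately have "lookup (p * q) m = lookup (?p * ?q) m"
    by (subst eq) (simp add: lookup_add in_keys_iff)
  then have mk: "m \<in> keys (p * q)" using m by (simp add: in_keys_iff)
  have "wdeg n u x \<le> ?a + ?b" if "x \<in> keys (p * q)" for x
  proof -
    obtain a b where "a \<in> keys p" "b \<in> keys q" "x = a + b" using \<open>x \<in> keys (p * q)\<close> by (rule in_keys_multE)
    then show ?thesis using wdeg_le_wtop[of a p n u] wdeg_le_wtop[of b q n u] by (simp add: wdeg_add)
  qed
  then show ?thesis unfolding wtop_def[of n u "p * q"] using mk wm
    by (intro Max_eqI) (auto intro: rev_image_eqI)
qed

text \<open>The lowest degree is, up to sign, the top degree for the negated weights; both are additive,
  and they agree on the product.\<close>
lemma uhom_factor:
  fixes p q :: "'a::idom mpoly"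
  assumes "uhom n u d (p * q)" "p * q \<noteq> 0"
  obtains a where "uhom n u a p" "uhom n u (d - a) q"
proof -
  let ?w = "\<lambda>i. - u i"
  have nz: "p \<noteq> 0" "q \<noteq> 0" using assms by auto
  have "uhom n ?w (- d) (p * q)" using assms by (simp add: uhom_def wdeg_uminus)
  then have 1: "wtop n ?w p + wtop n ?w q = - d"
    using wtop_mult[OF nz, of n ?w] wtop_uhom[OF assms(2)] by simp
  have 2: "wtop n u p + wtop n u q = d"
    using wtop_mult[OF nz, of n u] wtop_uhom[OF assms(2)] assms(1) by simp
  have le: "- wtop n ?w r \<le> wdeg n u m" "wdeg n u m \<le> wtop n u r"
    if "m \<in> keys r" for m and r :: "'a mpoly"
    using wdeg_le_wtop[OF that, of n ?w] wdeg_le_wtop[OF that, of n u] by (auto simp: wdeg_uminus)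
  have 3: "- wtop n ?w r \<le> wtop n u r" if r: "r \<noteq> 0" for r :: "'a mpoly"
  proof -
    obtain m where "m \<in> keys r" using r wtop_attained by blast
    then show ?thesis using le by fastforce
  qed
  \<comment> \<open>For each factor, top degree minus lowest degree is nonnegative; by
    \<open>1\<close> and \<open>2\<close> these two spreads add up to 0, so both vanish.\<close>
  have "- wtop n ?w p = wtop n u p" "- wtop n ?w q = wtop n u q"
    using 1 2 3[OF nz(1)] 3[OF nz(2)] by auto
  then have "uhom n u (wtop n u p) p" "uhom n u (d - wtop n u p) q"
    using le 2 unfolding uhom_def by (metis antisym, smt (verit))
  then show ?thesis by (rule that)
qed

text \<open>Grade by the exponent of a single variable x_j with j >= n. The product has degree 0, so
  the factors are homogeneous of degrees a and -a; both are exponents, hence nonnegative, hence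
  0.\<close>

lemma inS_factor:
  fixes p q :: "'a::idom mpoly"
  assumes "inS n (p * q)" "p * q \<noteq> 0"
  shows "inS n p"
  unfolding inS_def
proof (intro ballI)
  fix m j assume m: "m \<in> keys p" and j: "j \<in> keys m"
  show "j < n"
  proof (rule ccontr)
    assume jn: "\<not> j < n"
    let ?w = "\<lambda>i. if i = j then 1 else 0"
    have w: "wdeg (Suc j) ?w x = int (lookup x j)" for x
      by (simp add: wdeg_def if_distrib if_distribR cong: if_cong)
    have "uhom (Suc j) ?w 0 (p * q)"
      using assms(1) jn unfolding inS_def uhom_def w by (metis not_in_keys_iff_lookup_eq_zero of_nat_0)
    then obtain a where a: "uhom (Suc j) ?w a p" "uhom (Suc j) ?w (0 - a) q"
      using assms(2) by (rule uhom_factor)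
    obtain m' where "m' \<in> keys q" using assms(2) by (metis keys_eq_empty ex_in_conv mult_zero_right)
    then have "int (lookup m' j) = - a" "int (lookup m j) = a"
      using a m unfolding uhom_def w by auto
    then show False using j by (simp add: in_keys_iff)
  qed
qed

lemma inS_dvd:
  fixes p q :: "'a::idom mpoly"
  assumes "p dvd q" "inS n q" "q \<noteq> 0" shows "inS n p"
  using assms inS_factor by (metis dvd_def)

lemma inS_cofactor:
  fixes p q :: "'a::idom mpoly"
  assumes "p dvd q" "inS n q" "p \<noteq> 0" obtains r where "q = p * r" "inS n r"
proof -
  obtain r where r: "q = p * r" using assms(1) by (rule dvdE)
  have "inS n r"
    using inS_factor[of n r p] assms(2,3) r by (cases "r = 0") (auto simp: mult.commute)
  then show ?thesis using that r by blast
qed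

section \<open>Units and existence of irreducible factors\<close>

lemma inS_unit: "p dvd 1 \<Longrightarrow> inS n (p :: 'a::idom mpoly)"
  by (rule inS_dvd[of p 1]) auto

lemma wtop_nonneg:
  assumes "p \<noteq> 0" "\<And>i. i < n \<Longrightarrow> 0 \<le> u i" shows "0 \<le> wtop n u p"
  by (metis assms wdeg_nonneg wtop_attained)

lemma const_if_keys_0: "(\<And>m. m \<in> keys p \<Longrightarrow> m = 0) \<Longrightarrow> p = single 0 (lookup p 0)"
  by (rule poly_mapping_eqI) (auto simp: lookup_single when_def in_keys_iff)

text \<open>Positive weights leave 1 as the only monomial of S of nonpositive degree, and a nonzero
  constant is invertible in a field.\<close>

lemma unit_if_wtop_0:
  fixes p :: "'a::field mpoly"
  assumes "p \<noteq> 0" "inS n p" "wtop n u p \<le> 0" and u: "\<And>i. i < n \<Longrightarrow> 0 < u i"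
  shows "p dvd 1"
proof -
  have "m = 0" if m: "m \<in> keys p" for m
  proof (rule poly_mapping_eqI)
    fix j
    have "(\<Sum>j<n. u j * int (lookup m j)) = 0"
      using wdeg_le_wtop[OF m, of n u] assms(3) wdeg_nonneg[of n u m] u
      by (simp add: wdeg_def less_imp_le)
    then have "\<forall>j<n. u j * int (lookup m j) = 0"
      by (subst (asm) sum_nonneg_eq_0_iff) (auto intro!: mult_nonneg_nonneg simp: less_imp_le[OF u])
    then have "j < n \<Longrightarrow> lookup m j = 0" using u by fastforce
    then show "lookup m j = lookup 0 j"
      using assms(2) m unfolding inS_def by (metis lookup_zero not_in_keys_iff_lookup_eq_zero)
  qed
  then have p: "p = single 0 (lookup p 0)" by (rule const_if_keys_0)
  have nz: "lookup p 0 \<noteq> 0" using assms(1) p by (metis single_zero)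
  have "p * single 0 (inverse (lookup p 0)) = 1"
    by (subst p) (simp add: mult_single nz)
  then show ?thesis by (metis dvd_triv_left)
qed

lemma unit_imp_const:
  fixes p :: "'a::field mpoly"
  assumes "p dvd 1" obtains c where "p = single 0 c" "c \<noteq> 0"
proof -
  \<comment> \<open>\<open>inS_unit\<close> holds for any number of variables; with none, only
    constants remain.\<close>
  have "inS 0 p" using assms by (rule inS_unit)
  then have "m = 0" if "m \<in> keys p" for m
    using that unfolding inS_def by (metis ex_in_conv keys_eq_empty not_less_zero)
  then have "p = single 0 (lookup p 0)" by (rule const_if_keys_0)
  moreover have "p \<noteq> 0" using assms by auto
  ultimately show ?thesis using that by (metis single_zero)
qed

lemma uhom_unit: "p dvd 1 \<Longrightarrow> uhom n u 0 (p :: 'a::field mpoly)"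
  by (erule unit_imp_const) (simp add: uhom_def)

lemma wtop_unit: "p dvd 1 \<Longrightarrow> wtop n u (p :: 'a::field mpoly) = 0"
  by (intro wtop_uhom uhom_unit) auto

text \<open>Nonunits have positive total degree, so in a factorization into two nonunits each factor
  has smaller degree than \<open>p\<close>.\<close>

lemma irreducible_factor_exists:
  fixes p :: "'a::field mpoly"
  assumes "inS n p" "p \<noteq> 0" "\<not> p dvd 1"
  shows "\<exists>f. irreducible f \<and> f dvd p \<and> inS n f"
  using assms
proof (induction "nat (wtop n (\<lambda>_. 1) p)" arbitrary: p rule: less_induct)
  case less
  let ?w = "\<lambda>_::nat. 1::int"
  show ?case
  proof (cases "irreducible p")
    case True
    then show ?thesis using less.prems by (intro exI[of _ p]) auto
  next
    case False
    then obtain a b where ab: "p = a * b" "\<not> a dvd 1" "\<not> b dvd 1"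
      using less.prems unfolding irreducible_def by blast
    have nz: "a \<noteq> 0" "b \<noteq> 0" using ab less.prems by auto
    have S: "inS n a" "inS n b"
      using inS_factor[of n a b] inS_factor[of n b a] ab less.prems by (auto simp: mult.commute)
    have "wtop n ?w a > 0" "wtop n ?w b > 0"
      using unit_if_wtop_0[of a n ?w] unit_if_wtop_0[of b n ?w] nz S ab by force+
    moreover have "wtop n ?w p = wtop n ?w a + wtop n ?w b" using wtop_mult nz ab by blast
    ultimately have "\<exists>f. irreducible f \<and> f dvd a \<and> inS n f"
      by (intro less.hyps) (use nz S ab in auto)
    then show ?thesis using ab by auto
  qed
qed

section \<open>Irreducible polynomials are prime\<close>

text \<open>Splitting off irreducible factors lowers the total degree. With this rule multipliers
  from S are cancelled factor by factor while uniqueness of factorization is still to be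
  proved.\<close>

lemma irreducible_factor_induct [consumes 2, case_names unit mult]:
  fixes c :: "'a::field mpoly"
  assumes "inS n c" "c \<noteq> 0"
    and unit: "\<And>c. c dvd 1 \<Longrightarrow> P c"
    and step: "\<And>f c. irreducible f \<Longrightarrow> inS n f \<Longrightarrow> inS n c \<Longrightarrow> c \<noteq> 0 \<Longrightarrow> P c \<Longrightarrow> P (f * c)"
  shows "P c"
  using assms(1,2)
proof (induction "nat (wtop n (\<lambda>_. 1) c)" arbitrary: c rule: less_induct)
  case less
  let ?w = "\<lambda>_::nat. 1::int"
  show ?case
  proof (cases "c dvd 1")
    case True
    then show ?thesis by (rule unit)
  next
    case False
    then obtain f where f: "irreducible f" "f dvd c" "inS n f"
      using irreducible_factor_exists less.prems by blast
    then have fnz: "f \<noteq> 0" "\<not> f dvd 1" by (auto simp: irreducible_def)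
    obtain b where b: "c = f * b" "inS n b" using inS_cofactor f(2) less.prems(1) fnz(1) by blast
    have bnz: "b \<noteq> 0" using b less.prems by auto
    have "wtop n ?w f > 0" using unit_if_wtop_0[of f n ?w] fnz f by force
    moreover have "wtop n ?w c = wtop n ?w f + wtop n ?w b" using wtop_mult fnz bnz b by blast
    moreover have "wtop n ?w b \<ge> 0" using wtop_nonneg[OF bnz] by simp
    ultimately have "P b" by (intro less.hyps) (use b bnz in auto)
    then show ?thesis using step f b bnz by blast
  qed
qed

text \<open>\<open>K[x\<^sub>0, \<dots>, x\<^sub>n] = K[x\<^sub>0, \<dots>, x\<^sub>n\<^sub>-\<^sub>1][x\<^sub>n]\<close> is accessed through evaluation at \<open>x\<^sub>n\<close> of
  univariate polynomials whose coefficients do not involve \<open>x\<^sub>n\<close>.\<close>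

definition var :: "nat \<Rightarrow> 'a::comm_semiring_1 mpoly" where
  "var n = single (single n 1) 1"

lemma var_power: "var n ^ k = single (single n k) 1"
  by (induction k) (auto simp: var_def mult_single single_add[symmetric])

lemma inS_var: "i < n \<Longrightarrow> inS n (var i)"
  by (simp add: var_def inS_single)

lemma poly_mapping_sum_singles: "p = (\<Sum>m\<in>keys p. single m (lookup p m))"
proof (rule poly_mapping_eqI)
  fix k
  have "lookup (\<Sum>m\<in>keys p. single m (lookup p m)) k = (\<Sum>m\<in>keys p. if m = k then lookup p m else 0)"
    by (simp add: lookup_sum lookup_single when_def)
  also have "\<dots> = lookup p k" by (simp add: in_keys_iff)
  finally show "lookup p k = lookup (\<Sum>m\<in>keys p. single m (lookup p m)) k" ..
qed

lemma inS_poly: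
  assumes "\<And>k. inS n (coeff P k)" "inS n x"
  shows "inS n (poly P x :: 'a::comm_semiring_1 mpoly)"
  unfolding poly_altdef using assms by (intro inS_sum inS_mult inS_power)

lemma coeffs_in_Suc_var:
  assumes "inS (Suc n) (p :: 'a::comm_semiring_1 mpoly)"
  obtains P where "\<forall>k. inS n (coeff P k)" "poly P (var n) = p"
proof -
  \<comment> \<open>Each monomial is split into its part free of x_n, which becomes a coefficient,
    and its power of x_n.\<close>
  let ?P = "\<Sum>m\<in>keys p. monom (single (m - single n (lookup m n)) (lookup p m)) (lookup m n)"
  have "inS n (coeff ?P k)" for k
  proof -
    have "inS n (single (m - single n (lookup m n)) (lookup p m))" if m: "m \<in> keys p" for m
    proof -
      have "j < n" if "j \<in> keys (m - single n (lookup m n))" for j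
      proof -
        have "j \<noteq> n" "j \<in> keys m"
          using that by (auto simp: in_keys_iff lookup_minus lookup_single when_def split: if_splits)
        then show ?thesis using assms m unfolding inS_def using less_antisym by blast
      qed
      then show ?thesis by (simp add: inS_single)
    qed
    then show ?thesis by (auto simp: coeff_sum intro!: inS_sum)
  qed
  moreover have "poly ?P (var n) = p"
  proof -
    have "m - single n (lookup m n) + single n (lookup m n) = m" for m :: "nat \<Rightarrow>\<^sub>0 nat"
      by (rule poly_mapping_eqI) (simp add: lookup_add lookup_minus lookup_single when_def)
    then have "poly ?P (var n) = (\<Sum>m\<in>keys p. single m (lookup p m))"
      by (simp add: poly_sum poly_monom var_power mult_single)
    then show ?thesis using poly_mapping_sum_singles by metis
  qed
  ultimately show ?thesis using that by blast
qed

text \<open>The summands \<open>coeff P k * x\<^sub>n ^ k\<close> lie in distinct degrees of the grading by the exponent of \<open>x\<^sub>n\<close>.\<close>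
lemma poly_var_eq_0:
  fixes P :: "'a::idom mpoly poly"
  assumes S: "\<And>k. inS n (coeff P k)" and 0: "poly P (var n) = 0"
  shows "P = 0"
proof (rule poly_eqI)
  fix k
  let ?w = "\<lambda>i. if i = n then 1 else 0"
  have w: "wdeg (Suc n) ?w x = int (lookup x n)" for x
    by (simp add: wdeg_def if_distrib if_distribR cong: if_cong)
  have c: "uhom (Suc n) ?w 0 (coeff P i)" for i
    using S[of i] unfolding inS_def uhom_def w by (metis less_irrefl not_in_keys_iff_lookup_eq_zero of_nat_0)
  have "uhom (Suc n) ?w (int i) (var n ^ i :: 'a mpoly)" for i
    unfolding uhom_def w var_power by simp
  from uhom_mult[OF c this] have h: "uhom (Suc n) ?w (int i) (coeff P i * var n ^ i)" for i by simp
  have hc: "hcomp (Suc n) ?w (int k) (coeff P i * var n ^ i) = (if i = k then coeff P k * var n ^ k else 0)" for i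
    using h[of i] hcomp_id by (auto simp: uhom_def intro!: hcomp_eq_0)
  have "0 = hcomp (Suc n) ?w (int k) (poly P (var n))" using 0 by simp
  also have "\<dots> = (\<Sum>i\<le>degree P. if i = k then coeff P k * var n ^ k else 0)"
    unfolding poly_altdef hcomp_sum hc ..
  also have "\<dots> = (if k \<le> degree P then coeff P k * var n ^ k else 0)" by simp
  finally have "coeff P k * var n ^ k = 0" by (auto simp: coeff_eq_0 split: if_splits)
  moreover have "var n ^ k \<noteq> (0 :: 'a mpoly)"
    unfolding var_power by (metis lookup_single_eq lookup_zero zero_neq_one)
  ultimately show "coeff P k = coeff 0 k" by (metis coeff_0 mult_eq_0_iff)
qed

text \<open>Restricting the two factors to S with \<open>n\<close> variables makes primality a
  statement that can be carried from \<open>n\<close> to \<open>Suc n\<close> variables.\<close>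

definition prime_in :: "nat \<Rightarrow> 'a::comm_semiring_1 mpoly \<Rightarrow> bool" where
  "prime_in n f \<longleftrightarrow> (\<forall>g h. inS n g \<longrightarrow> inS n h \<longrightarrow> f dvd g * h \<longrightarrow> f dvd g \<or> f dvd h)"

lemma prime_inD: "prime_in n f \<Longrightarrow> f dvd g * h \<Longrightarrow> inS n g \<Longrightarrow> inS n h \<Longrightarrow> f dvd g \<or> f dvd h"
  by (auto simp: prime_in_def)

text \<open>Gauss's lemma: modulo a prime \<open>f\<close> of the coefficient ring, the product of
  two nonzero polynomials in x_n is nonzero.\<close>

lemma prime_in_Suc:
  fixes f :: "'a::idom mpoly"
  assumes f: "prime_in n f" "inS n f" "f \<noteq> 0"
  shows "prime_in (Suc n) f"
  unfolding prime_in_def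
proof (intro allI impI)
  fix g h assume g: "inS (Suc n) g" and h: "inS (Suc n) h" and dvd: "f dvd g * h"
  obtain G where G: "\<forall>k. inS n (coeff G k)" "poly G (var n) = g" by (rule coeffs_in_Suc_var[OF g])
  obtain H where H: "\<forall>k. inS n (coeff H k)" "poly H (var n) = h" by (rule coeffs_in_Suc_var[OF h])
  obtain q where q: "g * h = f * q" "inS (Suc n) q"
    using inS_cofactor[OF dvd inS_mult[OF g h] f(3)] by blast
  obtain R where R: "\<forall>k. inS n (coeff R k)" "poly R (var n) = q" by (rule coeffs_in_Suc_var[OF q(2)])
  \<comment> \<open>Evaluation at x_n is injective on polynomials with coefficients free of x_n, so
    the identity \<open>g * h = f * q\<close> lifts.\<close>
  have "G * H - smult f R = 0"
  proof (rule poly_var_eq_0[of n])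
    show "inS n (coeff (G * H - smult f R) k)" for k
      using G H R f by (auto simp: coeff_mult intro!: inS_diff inS_sum inS_mult)
    show "poly (G * H - smult f R) (var n) = 0" using G H R q by simp
  qed
  then have GH: "f dvd coeff (G * H) k" for k by simp
  have ev: "f dvd poly P (var n)" if "\<And>k. f dvd coeff P k" for P
    unfolding poly_altdef using that by (intro dvd_sum) simp
  show "f dvd g \<or> f dvd h"
  proof (rule ccontr)
    assume "\<not> (f dvd g \<or> f dvd h)"
    then have "\<exists>i. \<not> f dvd coeff G i" "\<exists>j. \<not> f dvd coeff H j" using ev G H by blast+
    then obtain i j where i: "\<not> f dvd coeff G i" "\<forall>k<i. f dvd coeff G k"
      and j: "\<not> f dvd coeff H j" "\<forall>k<j. f dvd coeff H k"
      unfolding exists_least_iff[of "\<lambda>i. \<not> f dvd coeff _ i"] by blast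
    \<comment> \<open>\<open>i\<close> and \<open>j\<close> are the first indices of coefficients
      not divisible by \<open>f\<close>. In every other summand of this coefficient one of the two
      indices is smaller, so \<open>f\<close> divides it.\<close>
    have split: "coeff (G * H) (i + j) = coeff G i * coeff H j
        + (\<Sum>k\<in>{..i+j} - {i}. coeff G k * coeff H (i + j - k))"
      unfolding coeff_mult by (subst sum.remove[of _ i]) auto
    have "f dvd (\<Sum>k\<in>{..i+j} - {i}. coeff G k * coeff H (i + j - k))"
    proof (intro dvd_sum)
      fix k assume "k \<in> {..i+j} - {i}"
      then consider "k < i" | "i + j - k < j" by fastforce
      then show "f dvd coeff G k * coeff H (i + j - k)" using i(2) j(2) by cases auto
    qed
    then have "f dvd coeff G i * coeff H j"
      using GH[of "i + j"] unfolding split by (simp only: dvd_add_left_iff)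
    then show False using i(1) j(1) prime_inD[OF f(1)] G H by blast
  qed
qed

text \<open>Division with remainder over the fraction field, with denominators cleared: each step
  multiplies by the leading coefficient of \<open>W\<close>, which is why \<open>F\<close> acquires
  a nonzero factor free of the last variable.\<close>

lemma pseudo_division:
  fixes F W :: "'a::idom mpoly poly"
  assumes "\<And>k. inS n (coeff W k)" "W \<noteq> 0" "\<And>k. inS n (coeff F k)"
  shows "\<exists>c A R. inS n c \<and> c \<noteq> 0 \<and> (\<forall>k. inS n (coeff A k)) \<and> (\<forall>k. inS n (coeff R k)) \<and>
    smult c F = A * W + R \<and> (R = 0 \<or> degree R < degree W)"
  using assms(3)
proof (induction "degree F" arbitrary: F rule: less_induct)
  case less
  show ?case
  proof (cases "F = 0 \<or> degree F < degree W")
    case True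
    then show ?thesis using less.prems by (intro exI[of _ 1] exI[of _ 0] exI[of _ F]) auto
  next
    case False
    let ?l = "lead_coeff W" and ?m = "monom (lead_coeff F) (degree F - degree W)"
    let ?F = "smult ?l F - ?m * W"
    have S: "inS n (coeff ?F k)" for k
      using less.prems assms(1) by (auto simp: coeff_mult intro!: inS_diff inS_sum inS_mult)
    \<comment> \<open>When \<open>F\<close> and \<open>W\<close> are both constants the degree
      cannot drop further, but then the difference is zero.\<close>
    have "degree ?F < degree F \<or> ?F = 0"
    proof (cases "degree F = 0")
      case True
      then have "coeff ?F k = 0" for k
        using False by (cases k) (auto simp: coeff_monom_mult coeff_eq_0)
      then show ?thesis using poly_eqI[of ?F 0] by (metis coeff_0)
    next
      case F0: False
      have "coeff ?F (degree F) = 0" using False by (simp add: coeff_monom_mult)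
      moreover have "degree ?F \<le> degree F"
        using False by (intro degree_diff_le degree_smult_le order_trans[OF degree_mult_le])
          (auto intro: order_trans[OF add_right_mono[OF degree_monom_le]])
      ultimately show ?thesis
        using F0 by (metis coeff_0 le_neq_implies_less leading_coeff_0_iff)
    qed
    moreover have "?thesis" if lt: "degree ?F < degree F"
    proof -
      obtain c A R where c: "inS n c" "c \<noteq> 0" "\<forall>k. inS n (coeff A k)" "\<forall>k. inS n (coeff R k)"
        "smult c ?F = A * W + R" "R = 0 \<or> degree R < degree W"
        using less.hyps[OF lt S] by blast
      have "smult (c * ?l) F = (A + smult c ?m) * W + R"
        using c(5) by (simp add: smult_diff_right algebra_simps)
      moreover have "inS n (coeff (A + smult c ?m) k)" for k
        using c less.prems by (auto intro!: inS_add inS_mult)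
      ultimately show ?thesis using c assms(1,2) 
        by (intro exI[of _ "c * ?l"] exI[of _ "A + smult c ?m"] exI[of _ R]) (auto intro!: inS_mult)
    qed
    moreover have ?thesis if "?F = 0"
    proof -
      have "smult ?l F = ?m * W + 0" using that by simp
      moreover have "inS n (coeff ?m k)" for k using less.prems by auto
      ultimately show ?thesis using assms(1,2)
        by (intro exI[of _ ?l] exI[of _ ?m] exI[of _ 0]) auto
    qed
    ultimately show ?thesis by blast
  qed
qed

text \<open>Each irreducible factor of \<open>c\<close> is prime also with one more variable, so it
  can be cancelled from \<open>q\<close> or from \<open>w\<close>. What is cancelled from
  \<open>w\<close> is collected in \<open>b\<close>; what remains is a genuine factorization of
  \<open>f\<close>.\<close>

lemma dvd_const_mult_split:
  fixes f :: "'a::field mpoly"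
  assumes prime: "\<And>p :: 'a mpoly. irreducible p \<Longrightarrow> inS n p \<Longrightarrow> prime_in (Suc n) p"
    and "inS n c" "c \<noteq> 0" "c * f = q * w" "inS (Suc n) q" "inS (Suc n) w" 
  shows "\<exists>b w' q'. inS n b \<and> w = b * w' \<and> f = q' * w'"
  using assms(2-)
proof (induction c arbitrary: q w rule: irreducible_factor_induct)
  case (unit c)
  then obtain c' where c': "c * c' = 1" by (metis dvdE)
  have "f = c' * q * w" using unit c' by (metis mult.assoc mult.commute mult_1)
  then show ?case by (intro exI[of _ 1] exI[of _ w] exI[of _ "c' * q"]) auto
next
  case (mult p c)
  have p0: "p \<noteq> 0" using mult by auto
  have "p dvd q * w" using mult by (metis dvd_triv_left mult.assoc)
  then have "p dvd q \<or> p dvd w" using prime_inD[OF prime[OF mult.hyps(1,2)]] mult.prems by blast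
  then show ?case
  proof
    assume "p dvd q"
    then obtain q1 where "q = p * q1" "inS (Suc n) q1" using inS_cofactor mult p0 by blast
    then show ?thesis using mult p0 by (metis mult.assoc mult_left_cancel)
  next
    assume "p dvd w"
    then obtain w1 where w1: "w = p * w1" "inS (Suc n) w1" using inS_cofactor mult p0 by blast
    then have "c * f = q * w1" using mult.prems p0 by (simp add: algebra_simps)
    then obtain b w' q' where "inS n b" "w1 = b * w'" "f = q' * w'" using mult w1 by blast
    then show ?thesis using w1 mult by (metis inS_mult mult.assoc)
  qed
qed

text \<open>Primality is applied to the irreducible factors \<open>p\<close> of \<open>c\<close>,
  not to \<open>f\<close>, for which it is the goal. Such a \<open>p\<close> cannot divide
  \<open>f\<close>: it would be an associate of \<open>f\<close>, which involves the last variable.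
  So \<open>p\<close> divides the cofactor and cancels.\<close>

lemma dvd_const_mult_cancel:
  fixes f :: "'a::field mpoly"
  assumes prime: "\<And>p :: 'a mpoly. irreducible p \<Longrightarrow> inS n p \<Longrightarrow> prime_in (Suc n) p"
    and f: "irreducible f" "inS (Suc n) f" "\<not> inS n f"
    and "inS n c" "c \<noteq> 0" "f dvd c * g" "inS (Suc n) g"
  shows "f dvd g"
  using assms(5-)
proof (induction c rule: irreducible_factor_induct)
  case (unit c)
  then obtain c' where "c' * c = 1" by (metis dvdE mult.commute)
  then have "c' * (c * g) = g" by (simp flip: mult.assoc)
  then show ?case using unit by (metis dvd_mult)
next
  case (mult p c)
  have f0: "f \<noteq> 0" using f by auto
  have p0: "p \<noteq> 0" "\<not> p dvd 1" using mult by (auto simp: irreducible_def)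
  have "inS (Suc n) (p * c * g)" using mult inS_mono[of n _ "Suc n"] by (auto intro!: inS_mult)
  then obtain q where q: "p * c * g = f * q" "inS (Suc n) q" using inS_cofactor mult.prems(1) f0 by blast
  then have "p dvd f * q" by (metis dvd_triv_left mult.assoc)
  moreover have "\<not> p dvd f"
  proof
    assume "p dvd f"
    then obtain r where r: "f = p * r" by (rule dvdE)
    then have "r dvd 1" using f(1) p0 irreducibleD by blast
    then have "inS n f" using r mult inS_unit inS_mult by blast
    then show False using f by simp
  qed
  ultimately have "p dvd q" using prime_inD[OF prime[OF mult.hyps(1,2)]] f q by blast
  then obtain r where "q = p * r" by (rule dvdE)
  then have "p * (c * g) = p * (f * r)" using q(1) by (simp add: algebra_simps)
  then have "f dvd c * g" using p0 by simp
  then show ?case using mult by blast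
qed

text \<open>If \<open>f\<close> divides \<open>g * h\<close> and involves the last variable, an element of least degree in that
  variable of the ideal \<open>(f, g)\<close> divides \<open>f\<close> and \<open>g\<close> up to factors not involving the variable.\<close>
lemma irreducible_imp_prime_in:
  fixes f :: "'a::field mpoly"
  assumes "irreducible f" "inS n f"
  shows "prime_in n f"
  using assms
proof (induction n arbitrary: f)
  case 0
  have "f \<noteq> 0" using 0 by auto
  \<comment> \<open>Without variables every nonzero polynomial is a constant, so there are no
    irreducible ones.\<close>
  then have "f dvd 1"
    using 0 wtop_uhom[of f 0 "\<lambda>_. 1" 0]
    by (intro unit_if_wtop_0[of f 0 "\<lambda>_. 1"]) (auto simp: uhom_def wdeg_def)
  then show ?case using 0 by (simp add: irreducible_def)
next
  case (Suc n)
  have prime: "prime_in (Suc n) p" if "irreducible p" "inS n p" for p :: "'a mpoly"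
    using Suc.IH[OF that] that by (intro prime_in_Suc) auto
  show ?case
  proof (cases "inS n f")
    case True
    then show ?thesis using prime Suc.prems by blast
  next
    case False
    have cancel: "f dvd g" if "inS n c" "c \<noteq> 0" "f dvd c * g" "inS (Suc n) g" for c g
      by (rule dvd_const_mult_cancel[OF _ Suc.prems False that]) (rule prime)
    show ?thesis
      unfolding prime_in_def
    proof (intro allI impI)
      fix g h assume g: "inS (Suc n) g" and h: "inS (Suc n) h" and dvd: "f dvd g * h"
      define T where "T = {P :: 'a mpoly poly. \<forall>k. inS n (coeff P k)}"
      obtain F where F: "F \<in> T" "poly F (var n) = f"
        unfolding T_def using coeffs_in_Suc_var[OF Suc.prems(2)] by blast
      obtain G where G: "G \<in> T" "poly G (var n) = g"
        unfolding T_def using coeffs_in_Suc_var[OF g] by blast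
      \<comment> \<open>The ideal of \<open>F\<close> and \<open>G\<close> without zero, so that an
        element of least degree is a usable divisor.\<close>
      define I where "I = {P. P \<noteq> 0 \<and> (\<exists>A\<in>T. \<exists>B\<in>T. P = A * F + B * G)}"
      have T_add: "P + P' \<in> T" "P - P' \<in> T" "P * P' \<in> T" if "P \<in> T" "P' \<in> T" for P P'
        using that unfolding T_def
        by (auto simp: coeff_mult intro!: inS_add inS_diff inS_sum inS_mult)
      have T_const: "[:c:] \<in> T" if "inS n c" for c
        using that unfolding T_def by (auto simp: coeff_pCons split: nat.splits)
      have T_S: "inS (Suc n) (poly P (var n))" if "P \<in> T" for P
        using that inS_mono[of n _ "Suc n"] by (intro inS_poly inS_var) (auto simp: T_def)
      have T01: "0 \<in> T" "1 \<in> T" unfolding T_def by auto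
      have "F \<noteq> 0" using F Suc.prems by auto
      then have "F \<in> I" unfolding I_def using T01 by force
      then obtain W where W: "W \<in> I" "\<And>P. P \<in> I \<Longrightarrow> degree W \<le> degree P"
        using ex_has_least_nat[of "\<lambda>P. P \<in> I" F degree] by blast
      then obtain A B where AB: "A \<in> T" "B \<in> T" "W = A * F + B * G" "W \<noteq> 0"
        unfolding I_def by blast
      have WT: "W \<in> T" using AB F G T_add by auto
      have div: "\<exists>c q. inS n c \<and> c \<noteq> 0 \<and> inS (Suc n) q \<and> c * poly P (var n) = q * poly W (var n)"
        if P: "P \<in> T" "P = A1 * F + B1 * G" "A1 \<in> T" "B1 \<in> T" for P A1 B1
      proof -
        obtain c C R where c: "inS n c" "c \<noteq> 0" "C \<in> T" "R \<in> T"
          "smult c P = C * W + R" "R = 0 \<or> degree R < degree W"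
          using pseudo_division[of n W P] AB WT P unfolding T_def by blast
        \<comment> \<open>The pseudo-remainder stays in the ideal but has degree below the least
          one, so it is zero.\<close>
        have "R = ([:c:] * A1 - C * A) * F + ([:c:] * B1 - C * B) * G"
          using c(5) AB(3) P(2) by (simp add: algebra_simps smult_add_right)
        moreover have "[:c:] * A1 - C * A \<in> T" "[:c:] * B1 - C * B \<in> T"
          using c AB P by (auto intro!: T_add T_const simp del: mult_pCons_left)
        ultimately have "R = 0 \<or> R \<in> I" unfolding I_def by blast
        then have "R = 0" using W(2) c(6) by fastforce
        then have "c * poly P (var n) = poly C (var n) * poly W (var n)"
          using arg_cong[OF c(5), of "\<lambda>P. poly P (var n)"] by simp
        then show ?thesis using c T_S by blast
      qed
      define w where "w = poly W (var n)"
      have w: "w = poly A (var n) * f + poly B (var n) * g" "inS (Suc n) w"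
        using AB(3) F G T_S[OF WT] by (simp_all add: w_def)
      have w0: "w \<noteq> 0" using poly_var_eq_0[of n W] AB WT unfolding w_def T_def by blast
      obtain c q where c: "inS n c" "c \<noteq> 0" "inS (Suc n) q" "c * f = q * w"
        using div[OF F(1), of 1 0] F T01 unfolding w_def by auto
      obtain c' q1 where c': "inS n c'" "c' \<noteq> 0" "c' * g = q1 * w"
        using div[OF G(1), of 0 1] G T01 unfolding w_def by auto
      obtain b w' q' where b: "inS n b" "w = b * w'" "f = q' * w'"
        using dvd_const_mult_split[OF prime c(1,2,4,3) w(2)] by blast
      \<comment> \<open>If \<open>w'\<close> is a unit, \<open>w\<close> is free of the last
        variable and \<open>f\<close> divides \<open>w * h\<close>, since \<open>w\<close> lies in
        the ideal of \<open>f\<close> and \<open>g\<close>. If \<open>q'\<close> is a unit,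
        \<open>f\<close> is an associate of \<open>w'\<close>, a divisor of \<open>w\<close>, which
        divides \<open>c' * g\<close>. Either way the multiplier cancels.\<close>
      then consider "w' dvd 1" | "q' dvd 1" using Suc.prems(1) irreducibleD by blast
      then show "f dvd g \<or> f dvd h"
      proof cases
        case 1
        then have wS: "inS n w" using b inS_unit inS_mult by blast
        have "w * h = poly A (var n) * h * f + poly B (var n) * (g * h)"
          unfolding w(1) by (simp add: algebra_simps)
        then have "f dvd w * h" using dvd by simp
        then show ?thesis using cancel[OF wS w0 _ h] by blast
      next
        case 2
        then obtain q'' where "q'' * q' = 1" by (metis dvdE mult.commute)
        then have "q'' * f = w'" unfolding b(3) by (simp flip: mult.assoc)
        then have "f dvd w'" by (metis dvd_triv_right)
        then have "f dvd q1 * (b * w')" by (intro dvd_mult)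
        then have "f dvd c' * g" unfolding c'(3) b(2) .
        then show ?thesis using cancel[OF c'(1,2) _ g] by blast
      qed
    qed
  qed
qed

section \<open>Dimensions of graded pieces\<close>

context vector_space
begin

text \<open>The ambient space of all sequences of polynomials is infinite-dimensional, so finiteness
  is recorded for each subspace; for a space with an infinite basis \<open>dim\<close> would be
  0.\<close>

definition finite_dim :: "'b set \<Rightarrow> bool" where
  "finite_dim V \<longleftrightarrow> (\<exists>B. finite B \<and> V \<subseteq> local.span B)"

lemma finite_dim_subset: "local.finite_dim W \<Longrightarrow> V \<subseteq> W \<Longrightarrow> local.finite_dim V"
  unfolding local.finite_dim_def by blast

lemma finite_if_independent: "local.finite_dim V \<Longrightarrow> local.independent B \<Longrightarrow> B \<subseteq> V \<Longrightarrow> finite B"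
  unfolding local.finite_dim_def by (meson independent_span_bound subset_trans)

lemma dim_mono_finite_dim:
  assumes "local.finite_dim W" "V \<subseteq> W"
  shows "local.dim V \<le> local.dim W"
proof -
  obtain B where B: "B \<subseteq> W" "local.independent B" "W \<subseteq> local.span B" "card B = local.dim W" by (rule basis_exists)
  have "finite B" using finite_if_independent assms B by blast
  then show ?thesis using dim_le_card[of V B] B assms by force
qed

lemma span_Int_span_Diff:
  assumes "local.independent C" "B \<subseteq> C" "x \<in> local.span B" "x \<in> local.span (C - B)"
  shows "x = 0"
proof -
  have "local.representation C x = local.representation B x" "local.representation C x = local.representation (C - B) x"
    using assms by (auto intro!: representation_extend)
  then have "local.representation C x b = 0" for b
    by (metis DiffD2 representation_ne_zero)
  moreover have "x \<in> local.span C" using assms span_mono by blast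
  ultimately show ?thesis using sum_nonzero_representation_eq[OF assms(1), of x] by simp
qed

end

text \<open>A basis \<open>B\<close> of the kernel is extended to a basis \<open>C\<close> of
  \<open>V\<close>; on the span of \<open>C - B\<close> the map is injective, and the images of
  these vectors span the image of \<open>V\<close>.\<close>

lemma (in Vector_Spaces.linear) rank_nullity:
  assumes V: "vs1.subspace V" "vs1.finite_dim V"
  shows "vs1.dim V = vs2.dim (f ` V) + vs1.dim {x \<in> V. f x = 0}"
proof -
  let ?K = "{x \<in> V. f x = 0}"
  obtain B where B: "B \<subseteq> ?K" "vs1.independent B" "?K \<subseteq> vs1.span B" "card B = vs1.dim ?K"
    by (rule vs1.basis_exists)
  then have "B \<subseteq> V" by blast
  then obtain C where C: "B \<subseteq> C" "C \<subseteq> V" "vs1.independent C" "V \<subseteq> vs1.span C"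
    using B(2) by (rule vs1.maximal_independent_subset_extend)
  have finC: "finite C" using vs1.finite_if_independent V C by blast
  have spanV: "vs1.span C = V" using C V by (metis vs1.span_subspace)
  have inj: "inj_on f (vs1.span (C - B))"
    unfolding inj_on_iff_eq_0[OF vs1.subspace_span]
  proof (intro ballI impI)
    fix x assume x: "x \<in> vs1.span (C - B)" "f x = 0"
    then have "x \<in> V" using spanV vs1.span_mono[of "C - B" C] by blast
    then have "x \<in> vs1.span B" using x B by blast
    then show "x = 0" using vs1.span_Int_span_Diff C x by blast
  qed
  have "vs2.independent (f ` (C - B))"
    using independent_injective_image[OF _ inj] vs1.independent_mono C by blast
  moreover have "vs2.span (f ` (C - B)) = vs2.span (f ` V)"
  proof -
    have "f b \<in> vs2.span (f ` (C - B))" if "b \<in> C" for b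
    proof (cases "b \<in> B")
      case True
      then have "f b = 0" using B(1) by blast
      then show ?thesis by (simp add: vs2.span_zero)
    next
      case False
      then show ?thesis using that by (intro vs2.span_base) auto
    qed
    then have "f ` C \<subseteq> vs2.span (f ` (C - B))" by blast
    then have "vs2.span (f ` C) \<subseteq> vs2.span (f ` (C - B))" by (simp add: vs2.span_minimal)
    moreover have "vs2.span (f ` C) = f ` V" using span_image spanV by metis
    moreover have "vs2.span (f ` V) = f ` V" using subspace_image[OF V(1)] by simp
    moreover have "vs2.span (f ` (C - B)) \<subseteq> vs2.span (f ` C)" by (intro vs2.span_mono) auto
    ultimately show ?thesis by (metis subset_antisym)
  qed
  ultimately have "vs2.dim (f ` V) = card (f ` (C - B))" by (intro vs2.dim_eq_card)
  also have "\<dots> = card (C - B)"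
    using inj_on_subset[OF inj vs1.span_superset] by (rule card_image)
  also have "\<dots> = card C - card B" using C finC by (simp add: card_Diff_subset finite_subset)
  finally have "vs2.dim (f ` V) + card B = card C" using card_mono[OF finC C(1)] by simp
  moreover have "vs1.dim V = card C" using C vs1.basis_card_eq_dim by metis
  ultimately show ?thesis using B by simp
qed

lemma (in Vector_Spaces.linear) dim_image_inj:
  assumes "vs1.subspace V" "vs1.finite_dim V" "\<And>x. x \<in> V \<Longrightarrow> f x = 0 \<Longrightarrow> x = 0"
  shows "vs2.dim (f ` V) = vs1.dim V"
proof -
  have "{x \<in> V. f x = 0} = {0}" using assms vs1.subspace_0 by auto
  moreover have "vs1.dim {0} = 0"
    by (rule vs1.dim_unique[of "{}"]) (use vs1.independent_empty in auto)
  ultimately show ?thesis using rank_nullity[OF assms(1,2)] by simp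
qed

section \<open>Graded free modules of finite rank inside one vector space\<close>

definition fscale :: "'a::field \<Rightarrow> (nat \<Rightarrow> 'a mpoly) \<Rightarrow> nat \<Rightarrow> 'a mpoly" where
  "fscale c a = (\<lambda>i. single 0 c * a i)"

lemma fscale_apply [simp]: "fscale c a i = single 0 c * a i"
  by (simp add: fscale_def)

lemma lookup_const_mult: "lookup (single 0 c * p) m = c * lookup p (m :: nat \<Rightarrow>\<^sub>0 nat)"
  for c :: "'a::field"
  by (simp flip: mult_map_scale_conv_mult add: Poly_Mapping.map.rep_eq when_def)

interpretation fv: vector_space fscale
  by unfold_locales
    (auto simp: fun_eq_iff algebra_simps single_add mult_single mult.assoc[symmetric])

lemma sum_fun_apply: "(\<Sum>x\<in>A. f x) i = (\<Sum>x\<in>A. f x i)"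
  by (induction A rule: infinite_finite_induct) auto

text \<open>Cutting off at \<open>t\<close> makes the image of a tuple again a zero-padded sequence,
  so that lying in the kernel means being the zero function.\<close>

definition matmap :: "(nat \<Rightarrow> nat \<Rightarrow> 'a::field mpoly) \<Rightarrow> nat \<Rightarrow> nat \<Rightarrow> (nat \<Rightarrow> 'a mpoly) \<Rightarrow> nat \<Rightarrow> 'a mpoly" where
  "matmap M t r c = (\<lambda>j. if j < t then mapply M r c j else 0)"

lemma linear_matmap: "Vector_Spaces.linear fscale fscale (matmap M t r)"
  unfolding Vector_Spaces.linear_iff
  by (auto simp: fv.vector_space_axioms matmap_def mapply_def fun_eq_iff algebra_simps
      sum.distrib sum_distrib_left)

lemma matmap_apply: "matmap M t r c j = (if j < t then \<Sum>i<r. M j i * c i else 0)"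
  by (simp add: matmap_def mapply_def)

text \<open>The degree \<open>s\<close> part of the graded free module with generators in degrees
  \<open>d 0\<close>, ..., \<open>d (r - 1)\<close>. Padding with zeros lets modules of all ranks
  share one vector space.\<close>

definition piece :: "nat \<Rightarrow> (nat \<Rightarrow> int) \<Rightarrow> nat \<Rightarrow> (nat \<Rightarrow> int) \<Rightarrow> int \<Rightarrow> (nat \<Rightarrow> 'a::field mpoly) set" where
  "piece n u r d s = {c. (\<forall>i<r. inS n (c i) \<and> uhom n u (s - d i) (c i)) \<and> (\<forall>i\<ge>r. c i = 0)}"

definition monoms :: "nat \<Rightarrow> (nat \<Rightarrow> int) \<Rightarrow> int \<Rightarrow> (nat \<Rightarrow>\<^sub>0 nat) set" where
  "monoms n u s = {m. (\<forall>j\<in>keys m. j < n) \<and> wdeg n u m = s}"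

lemma inS_const_mult: "inS n p \<Longrightarrow> inS n (single 0 c * p :: 'a::field mpoly)"
  by (rule inS_mult) (auto simp: inS_single)

lemma uhom_const_mult: "uhom n u d p \<Longrightarrow> uhom n u d (single 0 c * p :: 'a::field mpoly)"
  using uhom_mult[of n u 0 "single 0 c" d p] by (simp add: uhom_def)

lemma subspace_piece: "fv.subspace (piece n u r d s)"
  by (rule fv.subspaceI)
    (auto simp: piece_def inS_add uhom_add inS_const_mult uhom_const_mult)

lemma matmap_piece:
  assumes "\<And>j i. j < t \<Longrightarrow> i < r \<Longrightarrow> inS n (M j i) \<and> uhom n u (d i - d' j) (M j i)"
    and "c \<in> piece n u r d s"
  shows "matmap M t r c \<in> piece n u t d' s"
proof -
  have "uhom n u (s - d' j) (M j i * c i)" if "j < t" "i < r" for i j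
    using uhom_mult[of n u "d i - d' j" "M j i" "s - d i" "c i"] assms that by (auto simp: piece_def)
  then show ?thesis
    using assms by (auto simp: piece_def matmap_apply intro!: inS_sum inS_mult uhom_sum)
qed

lemma monoms_lookup_le:
  assumes "\<And>i. i < n \<Longrightarrow> 0 < u i" "m \<in> monoms n u s" "j < n"
  shows "int (lookup m j) \<le> s"
proof -
  have "int (lookup m j) \<le> u j * int (lookup m j)"
    using assms(1)[OF assms(3)] mult_right_mono[of 1 "u j" "int (lookup m j)"] by simp
  also have "\<dots> \<le> wdeg n u m"
    unfolding wdeg_def using assms
    by (intro member_le_sum) (auto intro!: mult_nonneg_nonneg simp: less_imp_le)
  finally show ?thesis using assms(2) by (simp add: monoms_def)
qed

text \<open>Weights are at least 1, so all exponents are bounded by \<open>s\<close> and the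
  monomials embed into a cube. The polynomial growth later gives convergence of the Hilbert
  series.\<close>

lemma card_monoms:
  assumes "\<And>i. i < n \<Longrightarrow> 0 < u i"
  shows "finite (monoms n u s)" "card (monoms n u s) \<le> (nat s + 1) ^ n"
proof -
  let ?r = "\<lambda>m. \<lambda>j\<in>{..<n}. lookup m j"
  have inj: "inj_on ?r (monoms n u s)"
  proof (rule inj_onI, rule poly_mapping_eqI)
    fix m m' j assume m: "m \<in> monoms n u s" "m' \<in> monoms n u s" and eq: "?r m = ?r m'"
    show "lookup m j = lookup m' j"
    proof (cases "j < n")
      case True
      then show ?thesis using fun_cong[OF eq, of j] by simp
    next
      case False
      then have "j \<notin> keys m" "j \<notin> keys m'" using m by (auto simp: monoms_def)
      then show ?thesis by (simp add: in_keys_iff)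
    qed
  qed
  have sub: "?r ` monoms n u s \<subseteq> PiE {..<n} (\<lambda>_. {..nat s})"
  proof
    fix g assume "g \<in> ?r ` monoms n u s"
    then obtain m where m: "m \<in> monoms n u s" "g = ?r m" by blast
    have "lookup m j \<le> nat s" if "j < n" for j
      using monoms_lookup_le[of n u m s j] assms m(1) that by simp
    then show "g \<in> PiE {..<n} (\<lambda>_. {..nat s})" using m(2) by auto
  qed
  have fin: "finite (PiE {..<n} (\<lambda>_. {..nat s}))" by (intro finite_PiE) auto
  show "finite (monoms n u s)" using inj sub fin by (metis finite_imageD finite_subset)
  have "card (monoms n u s) \<le> card (PiE {..<n} (\<lambda>_. {..nat s}))"
    using card_mono[OF fin sub] card_image[OF inj] by simp
  then show "card (monoms n u s) \<le> (nat s + 1) ^ n" by (simp add: card_PiE)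
qed

lemma monoms_neg:
  assumes "\<And>i. i < n \<Longrightarrow> 0 < u i" "s < 0" shows "monoms n u s = {}"
proof -
  have "0 \<le> s" if "m \<in> monoms n u s" for m
    using wdeg_nonneg[of n u m] assms(1) that by (simp add: monoms_def less_imp_le)
  then show ?thesis using assms(2) by force
qed

lemma piece_dim:
  assumes u: "\<And>i. i < n \<Longrightarrow> 0 < u i"
  shows "fv.dim (piece n u r d s :: (nat \<Rightarrow> 'a::field mpoly) set) = (\<Sum>i<r. card (monoms n u (s - d i)))"
    and "fv.finite_dim (piece n u r d s :: (nat \<Rightarrow> 'a mpoly) set)"
proof -
  define e :: "nat \<times> (nat \<Rightarrow>\<^sub>0 nat) \<Rightarrow> nat \<Rightarrow> 'a mpoly"
    where "e = (\<lambda>(i,m) j. if j = i then single m 1 else 0)"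
  define I where "I = Sigma {..<r} (\<lambda>i. monoms n u (s - d i))"
  have finI: "finite I" unfolding I_def using card_monoms u by (intro finite_SigmaI) auto
  \<comment> \<open>This formula for the coordinates of a linear combination yields both
    independence and spanning.\<close>
  have lk: "lookup ((\<Sum>x\<in>I. fscale (U x) (e x)) j) m = (if (j,m) \<in> I then U (j,m) else 0)" for U j m
  proof -
    have "lookup ((\<Sum>x\<in>I. fscale (U x) (e x)) j) m = (\<Sum>x\<in>I. if x = (j,m) then U x else 0)"
      unfolding sum_fun_apply lookup_sum
      by (intro sum.cong refl) (auto simp: e_def lookup_const_mult lookup_single when_def split: prod.splits)
    then show ?thesis using finI by simp
  qed
  have inj: "inj_on e I"
  proof (rule inj_onI)
    fix x y assume "e x = e y"
    then have "lookup (e x (fst x)) (snd x) = lookup (e y (fst x)) (snd x)" by simp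
    then show "x = y" by (auto simp: e_def lookup_single when_def split: prod.splits if_splits)
  qed
  have "fv.independent (e ` I)"
    unfolding fv.dependent_finite[OF finite_imageI[OF finI]]
  proof safe
    fix U j m assume jm: "(j, m) \<in> I" and nz: "U (e (j, m)) \<noteq> 0" and "(\<Sum>v\<in>e ` I. fscale (U v) v) = 0"
    then have "(\<Sum>x\<in>I. fscale (U (e x)) (e x)) = 0" by (simp add: sum.reindex[OF inj])
    then show False using lk[of "U \<circ> e" j m] jm nz by simp
  qed
  moreover have "e ` I \<subseteq> piece n u r d s"
    by (auto simp: I_def e_def piece_def inS_single uhom_def monoms_def split: if_splits)
  moreover have sub: "piece n u r d s \<subseteq> fv.span (e ` I)"
  proof
    fix c :: "nat \<Rightarrow> 'a mpoly" assume c: "c \<in> piece n u r d s"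
    have "c = (\<Sum>x\<in>I. fscale (lookup (c (fst x)) (snd x)) (e x))"
    proof (rule ext, rule poly_mapping_eqI)
      fix j m
      have "lookup (c j) m = 0" if "(j, m) \<notin> I"
      proof (cases "j < r")
        case True
        then have "m \<notin> keys (c j)" using c that by (auto simp: I_def piece_def monoms_def inS_def uhom_def)
        then show ?thesis by (simp add: in_keys_iff)
      next
        case False
        then show ?thesis using c by (auto simp: piece_def)
      qed
      then show "lookup (c j) m = lookup ((\<Sum>x\<in>I. fscale (lookup (c (fst x)) (snd x)) (e x)) j) m"
        unfolding lk by simp
    qed
    also have "\<dots> \<in> fv.span (e ` I)" by (intro fv.span_sum fv.span_scale fv.span_base) auto
    finally show "c \<in> fv.span (e ` I)" .
  qed
  ultimately have "fv.dim (piece n u r d s :: (nat \<Rightarrow> 'a mpoly) set) = card (e ` I)"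
    by (metis fv.basis_card_eq_dim)
  also have "\<dots> = card I" by (rule card_image[OF inj])
  also have "\<dots> = (\<Sum>i<r. card (monoms n u (s - d i)))"
    unfolding I_def using card_monoms u by (intro card_SigmaI) auto
  finally show "fv.dim (piece n u r d s :: (nat \<Rightarrow> 'a mpoly) set) = \<dots>" .
  show "fv.finite_dim (piece n u r d s :: (nat \<Rightarrow> 'a mpoly) set)"
    unfolding fv.finite_dim_def using sub finI by blast
qed

section \<open>Logarithmic derivations\<close>

lemma uhom_dvd:
  fixes p q :: "'a::idom mpoly"
  assumes "p dvd q" "q \<noteq> 0" "uhom n u d q"
  obtains a where "uhom n u a p"
  using assms uhom_factor by (metis dvdE)

lemma dvd_hcomp:
  fixes g p :: "'a::comm_ring_1 mpoly"
  assumes "uhom n u d g" "g dvd p"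
  shows "g dvd hcomp n u s p"
proof -
  obtain r where "p = g * r" using assms(2) by (rule dvdE)
  then show ?thesis using hcomp_mult[OF assms(1)] by simp
qed

text \<open>The i-th summand has degree (t - v_i) + (c - u_i), which is t - k + c for every i
  exactly because u_i + v_i = k.\<close>

lemma apply_der_hcompD:
  fixes g :: "'a::comm_ring_1 mpoly"
  assumes uv: "\<And>i. i < n \<Longrightarrow> u i + v i = k" and g: "uhom n u c g"
  shows "apply_der n (hcompD n u v t a) g = hcomp n u (t - k + c) (apply_der n a g)"
  unfolding apply_der_def hcomp_sum hcompD_def
proof (rule sum.cong[OF refl])
  fix i assume i: "i \<in> {..<n}"
  have "hcomp n u (t - k + c) (pdiff i g * a i) = pdiff i g * hcomp n u (t - k + c - (c - u i)) (a i)"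
    using i by (intro hcomp_mult uhom_pdiff g) auto
  moreover have "t - k + c - (c - u i) = t - v i" using uv[of i] i by simp
  ultimately show "hcomp n u (t - v i) (a i) * pdiff i g = hcomp n u (t - k + c) (a i * pdiff i g)"
    by (simp add: mult.commute)
qed

text \<open>Irreducible factors of a homogeneous \<open>Q\<close> are homogeneous, and a homogeneous
  divisor of a polynomial divides each of its components.\<close>

lemma hcompD_Dlog:
  fixes Q :: "'a::idom mpoly"
  assumes uv: "\<And>i. i < n \<Longrightarrow> u i + v i = k" and Q: "Q \<noteq> 0" "uhom n u q Q"
    and a: "a \<in> Dlog n Q"
  shows "hcompD n u v t a \<in> Dlog n Q"
  unfolding Dlog_def
proof (intro CollectI conjI allI impI)
  show "derS n (hcompD n u v t a)"
    using a by (auto simp: Dlog_def derS_def hcompD_def intro: inS_hcomp)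
  fix g e assume g: "inS n g" "irreducible g" "1 \<le> e" "g ^ e dvd Q" "\<not> g ^ Suc e dvd Q"
  then have "g dvd Q" by (metis One_nat_def dvd_power dvd_trans less_eq_Suc_le)
  then obtain c where c: "uhom n u c g" using Q by (rule uhom_dvd)
  have "g ^ e dvd apply_der n a g" using a g by (auto simp: Dlog_def)
  then show "g ^ e dvd apply_der n (hcompD n u v t a) g"
    using apply_der_hcompD[OF uv c] dvd_hcomp[OF uhom_power[OF c]] by simp
qed

text \<open>One factor \<open>g\<close> is moved out of \<open>y\<close> at a time. The lemma serves
  twice: to compare multiplicities in \<open>Q\<close> and \<open>Q'\<close>, and to show that
  \<open>f ^ e\<close> and \<open>h\<close> have only the obvious syzygies.\<close>

lemma prime_in_power_dvd:
  fixes g :: "'a::idom mpoly"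
  assumes "prime_in n g" "g \<noteq> 0" "\<not> g dvd h" "inS n h" "inS n y" "g ^ m dvd h * y"
  shows "g ^ m dvd y"
  using assms(5,6)
proof (induction m arbitrary: y)
  case 0
  then show ?case by simp
next
  case (Suc m)
  have "g dvd h * y" using Suc.prems by (metis dvd_mult_left power_Suc)
  then have "g dvd y" using prime_inD assms Suc.prems by blast
  then obtain z where z: "y = g * z" "inS n z" using inS_cofactor Suc.prems assms(2) by blast
  have "g * g ^ m dvd g * (h * z)" using Suc.prems(2) z by (simp add: mult.left_commute)
  then have "g ^ m dvd h * z" using assms(2) by simp
  then show ?case using Suc.IH z by simp
qed

lemma prime_in_not_dvd_power:
  fixes g :: "'a::idom mpoly"
  assumes "prime_in n g" "\<not> g dvd 1" "\<not> g dvd h" "inS n h"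
  shows "\<not> g dvd h ^ e"
  using assms prime_inD[OF assms(1)] by (induction e) (auto intro: inS_power)

lemma irreducible_dvd_sym:
  assumes "irreducible f" "irreducible g" "g dvd f"
  obtains c where "f = c * g" "c dvd 1"
proof -
  obtain c where c: "f = c * g" using assms(3) by (metis dvdE mult.commute)
  then have "c dvd 1" using assms irreducibleD[OF assms(1) c] by (auto simp: irreducible_def)
  then show ?thesis using that c by blast
qed

section \<open>The module of logarithmic derivations and its change under a prime power
  factor\<close>

lemma pdiff_const_mult: "pdiff i (single 0 c * p) = single 0 c * pdiff i (p :: 'a::field mpoly)"
  by (rule poly_mapping_eqI) (simp add: lookup_pdiff lookup_const_mult)

lemma apply_der_const_mult:
  "apply_der n a (single 0 c * p) = single 0 c * apply_der n a (p :: 'a::field mpoly)"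
  by (simp add: apply_der_def pdiff_const_mult sum_distrib_left mult.left_commute)

lemma apply_der_add: "apply_der n (\<lambda>i. a i + b i) g = apply_der n a g + apply_der n b g"
  by (simp add: apply_der_def sum.distrib distrib_right)

lemma apply_der_mult: "apply_der n (\<lambda>i. p * a i) g = p * apply_der n a g"
  by (simp add: apply_der_def sum_distrib_left mult.assoc)

lemma apply_der_cong: "(\<And>i. i < n \<Longrightarrow> a i = b i) \<Longrightarrow> apply_der n a g = apply_der n b g"
  by (simp add: apply_der_def)

lemma Dlog_cong: "(\<And>i. i < n \<Longrightarrow> a i = b i) \<Longrightarrow> a \<in> Dlog n Q \<longleftrightarrow> b \<in> Dlog n Q"
  using apply_der_cong[of n a b] by (simp add: Dlog_def derS_def)

lemma Dlog_0: "(\<lambda>_. 0) \<in> Dlog n Q"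
  by (simp add: Dlog_def derS_def apply_der_def)

lemma Dlog_add:
  assumes "a \<in> Dlog n Q" "b \<in> Dlog n Q" shows "(\<lambda>i. a i + b i) \<in> Dlog n Q"
  using assms by (auto simp: Dlog_def derS_def apply_der_add intro!: inS_add)

lemma Dlog_mult:
  assumes "a \<in> Dlog n Q" "inS n p" shows "(\<lambda>i. p * a i) \<in> Dlog n Q"
  using assms by (auto simp: Dlog_def derS_def apply_der_mult intro!: inS_mult)

lemma Dlog_sum:
  assumes "\<And>x. x \<in> A \<Longrightarrow> a x \<in> Dlog n Q"
  shows "(\<lambda>i. \<Sum>x\<in>A. a x i) \<in> Dlog n Q"
  using assms by (induction A rule: infinite_finite_induct) (auto simp: Dlog_0 Dlog_add)

text \<open>Irreducibles not associate to \<open>f\<close> have the same multiplicity in both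
  polynomials. \<open>Dlog\<close> also tests every associate of \<open>f\<close>, and these impose
  the same condition as \<open>f\<close>.\<close>

lemma Dlog_prime_power_mult:
  fixes f :: "'a::field mpoly"
  assumes f: "irreducible f" "inS n f" "1 \<le> e" and Q': "inS n Q'" "Q' \<noteq> 0" "\<not> f dvd Q'"
  shows "a \<in> Dlog n (f ^ e * Q') \<longleftrightarrow> a \<in> Dlog n Q' \<and> f ^ e dvd apply_der n a f"
proof -
  let ?Q = "f ^ e * Q'"
  have f0: "f \<noteq> 0" using f by auto
  have exact: "\<not> f ^ Suc e dvd ?Q"
  proof
    assume "f ^ Suc e dvd ?Q"
    then have "f ^ e * f dvd f ^ e * Q'" by (simp add: mult.commute)
    then show False using f0 Q' by simp
  qed
  have trans: "g ^ m dvd ?Q \<longleftrightarrow> g ^ m dvd Q'"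
    if g: "irreducible g" "inS n g" "\<not> g dvd f" for g and m :: nat
  proof -
    have p: "prime_in n g" using irreducible_imp_prime_in g by blast
    have "\<not> g dvd f ^ e"
      using g f p by (intro prime_in_not_dvd_power[of n]) (auto simp: irreducible_def)
    moreover have "g \<noteq> 0" using g by auto
    ultimately show ?thesis
      using prime_in_power_dvd[OF p _ _ inS_power[OF f(2)] Q'(1)] by (auto simp: dvd_mult)
  qed
  show ?thesis
  proof (intro iffI conjI)
    assume a: "a \<in> Dlog n ?Q"
    show "f ^ e dvd apply_der n a f" using a f exact by (auto simp: Dlog_def simp del: power_Suc)
    show "a \<in> Dlog n Q'"
      unfolding Dlog_def
    proof (intro CollectI conjI allI impI)
      show "derS n a" using a by (simp add: Dlog_def)
      fix g m assume g: "inS n g" "irreducible g" "1 \<le> m" "g ^ m dvd Q'" "\<not> g ^ Suc m dvd Q'"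
      have "g dvd Q'" using g by (metis One_nat_def dvd_power dvd_trans less_eq_Suc_le)
      have "\<not> g dvd f"
      proof
        assume "g dvd f"
        with f(1) g(2) obtain c where c: "f = c * g" "c dvd 1" by (rule irreducible_dvd_sym)
        then obtain c' where "c' * c = 1" by (metis dvdE mult.commute)
        then have "c' * f = g" using c by (simp flip: mult.assoc)
        then have "f dvd g" by (metis dvd_triv_right)
        then show False using \<open>g dvd Q'\<close> Q' dvd_trans by blast
      qed
      then show "g ^ m dvd apply_der n a g" using a g trans[of g] by (simp add: Dlog_def del: power_Suc)
    qed
  next
    assume a: "a \<in> Dlog n Q' \<and> f ^ e dvd apply_der n a f"
    show "a \<in> Dlog n ?Q"
      unfolding Dlog_def
    proof (intro CollectI conjI allI impI)
      show "derS n a" using a by (simp add: Dlog_def)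
      fix g m assume g: "inS n g" "irreducible g" "1 \<le> m" "g ^ m dvd ?Q" "\<not> g ^ Suc m dvd ?Q"
      show "g ^ m dvd apply_der n a g"
      proof (cases "g dvd f")
        case False
        then show ?thesis using a g trans[of g] by (simp add: Dlog_def del: power_Suc)
      next
        case True
        \<comment> \<open>Here \<open>g\<close> is a constant multiple of \<open>f\<close>, so its
          derivative is the same multiple of that of \<open>f\<close>; it remains to bound
          \<open>m\<close> by \<open>e\<close>.\<close>
        with f(1) g(2) obtain c where c: "f = c * g" "c dvd 1" by (rule irreducible_dvd_sym)
        obtain c0 where c0: "c = single 0 c0" "c0 \<noteq> 0" using c(2) by (rule unit_imp_const)
        let ?d = "single 0 (inverse c0) :: 'a mpoly"
        have d: "?d * c = 1" using c0 by (simp add: mult_single)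
        then have gf: "g = ?d * f" using c(1) by (simp flip: mult.assoc)
        have "f dvd g" using gf by (metis dvd_triv_right)
        then have "f ^ m dvd ?Q" using g(4) dvd_power_same dvd_trans by blast
        have "m \<le> e"
        proof (rule ccontr)
          assume "\<not> m \<le> e"
          then have "f ^ Suc e dvd f ^ m" by (intro le_imp_power_dvd) simp
          then show False using exact dvd_trans[OF _ \<open>f ^ m dvd ?Q\<close>] by blast
        qed
        then have "f ^ m dvd apply_der n a f" using a le_imp_power_dvd dvd_trans by blast
        then have "g ^ m dvd apply_der n a f" using dvd_power_same[OF True] dvd_trans by blast
        moreover have "apply_der n a g = ?d * apply_der n a f"
          by (subst gf) (rule apply_der_const_mult)
        ultimately show ?thesis by simp
      qed
    qed
  qed
qed

lemma Dlog_unit: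
  fixes Q :: "'a::field mpoly"
  assumes "Q dvd 1" shows "Dlog n Q = {a. derS n a}"
proof -
  have "\<not> g ^ e dvd Q" if "irreducible g" "1 \<le> e" for g e
  proof
    assume "g ^ e dvd Q"
    moreover have "g dvd g ^ e" using that(2) by (simp add: dvd_power)
    ultimately have "g dvd 1" using assms dvd_trans by blast
    then show False using that by (simp add: irreducible_def)
  qed
  then show ?thesis by (auto simp: Dlog_def)
qed

text \<open>Pick a monomial of \<open>f\<close> containing x_j. Dividing it by x_j gives a monomial
  of the derivative whose coefficient is multiplied by the exponent, and characteristic zero keeps
  this from vanishing.\<close>

lemma pdiff_nonzero:
  fixes f :: "'a::field_char_0 mpoly"
  assumes "inS n f" "f \<noteq> 0" "\<not> f dvd 1"
  obtains j where "j < n" "pdiff j f \<noteq> 0"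
proof -
  have "\<exists>m\<in>keys f. m \<noteq> 0"
  proof (rule ccontr)
    assume "\<not> (\<exists>m\<in>keys f. m \<noteq> 0)"
    then have "wtop n (\<lambda>_. 1) f = 0" by (intro wtop_uhom assms) (auto simp: uhom_def)
    then show False using unit_if_wtop_0[of f n "\<lambda>_. 1"] assms by simp
  qed
  then obtain m where m: "m \<in> keys f" "m \<noteq> 0" by blast
  then obtain j where j: "j \<in> keys m" by (metis keys_eq_empty ex_in_conv)
  have mj: "m - single j 1 + single j 1 = m"
    using j by (intro poly_mapping_eqI) (auto simp: lookup_add lookup_minus lookup_single when_def in_keys_iff)
  have "of_nat (lookup (m - single j 1) j + 1) \<noteq> (0 :: 'a)" by (metis Suc_eq_plus1 of_nat_neq_0)
  then have "lookup (pdiff j f) (m - single j 1) \<noteq> 0"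
    using m(1) unfolding lookup_pdiff mj by (simp add: in_keys_iff)
  then have "pdiff j f \<noteq> 0" by auto
  moreover have "j < n" using assms(1) m(1) j by (auto simp: inS_def)
  ultimately show ?thesis using that by blast
qed

text \<open>The derivative has degree \<open>c - u j\<close>, less than that of \<open>f\<close>,
  while a cofactor would have nonnegative degree.\<close>

lemma not_dvd_pdiff:
  fixes f :: "'a::field_char_0 mpoly"
  assumes u: "\<And>i. i < n \<Longrightarrow> 0 < u i" and f: "uhom n u c f" "f \<noteq> 0" and j: "j < n" "pdiff j f \<noteq> 0"
  shows "\<not> f dvd pdiff j f"
proof
  assume "f dvd pdiff j f"
  then obtain r where r: "pdiff j f = f * r" by (rule dvdE)
  then have r0: "r \<noteq> 0" using j by auto
  have "c - u j = c + wtop n u r"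
    using wtop_mult[OF f(2) r0, of n u] wtop_uhom[OF f(2,1)] wtop_uhom[OF j(2) uhom_pdiff[OF f(1) j(1)]] r
    by simp
  moreover have "0 \<le> wtop n u r" using u by (intro wtop_nonneg r0) (simp add: less_imp_le)
  ultimately show False using u[OF j(1)] by simp
qed

section \<open>Hilbert functions\<close>

definition hilb_Dlog :: "nat \<Rightarrow> (nat \<Rightarrow> int) \<Rightarrow> (nat \<Rightarrow> int) \<Rightarrow> 'a::field mpoly \<Rightarrow> int \<Rightarrow> nat" where
  "hilb_Dlog n u v Q s = fv.dim (Dlog n Q \<inter> piece n u n v s)"

lemma subspace_Dlog_piece: "fv.subspace (Dlog n Q \<inter> piece n u r d s)"
proof (rule fv.subspaceI)
  note P = fv.subspace_0[OF subspace_piece] fv.subspace_add[OF subspace_piece]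
    fv.subspace_scale[OF subspace_piece]
  show "0 \<in> Dlog n Q \<inter> piece n u r d s"
    using Dlog_0[of n Q] P(1) by (auto simp: zero_fun_def)
  show "x + y \<in> Dlog n Q \<inter> piece n u r d s"
    if "x \<in> Dlog n Q \<inter> piece n u r d s" "y \<in> Dlog n Q \<inter> piece n u r d s" for x y
    using that Dlog_add[of x n Q y] P(2) by (auto simp: plus_fun_def)
  show "fscale c x \<in> Dlog n Q \<inter> piece n u r d s" if "x \<in> Dlog n Q \<inter> piece n u r d s" for c x
    using that Dlog_mult[of x n Q "single 0 c"] P(3) by (auto simp: fscale_def inS_single)
qed

lemma hilb_Dlog_unit:
  fixes Q :: "'a::field mpoly"
  assumes "Q dvd 1"
  shows "hilb_Dlog n u v Q s = fv.dim (piece n u n v s :: (nat \<Rightarrow> 'a mpoly) set)"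
proof -
  have "Dlog n Q \<inter> piece n u n v s = piece n u n v s"
    using assms by (auto simp: Dlog_unit piece_def derS_def)
  then show ?thesis by (simp add: hilb_Dlog_def)
qed

lemma hilb_Dlog_le:
  fixes Q :: "'a::field mpoly"
  assumes u: "\<And>i. i < n \<Longrightarrow> 0 < u i"
  shows "hilb_Dlog n u v Q s \<le> (\<Sum>i<n. card (monoms n u (s - v i)))"
proof -
  have "fv.dim (Dlog n Q \<inter> piece n u n v s) \<le> fv.dim (piece n u n v s :: (nat \<Rightarrow> 'a mpoly) set)"
    by (rule fv.dim_mono_finite_dim[OF piece_dim(2)[OF u]]) auto
  then show ?thesis using piece_dim(1)[OF u, where ?'a = 'a] by (simp add: hilb_Dlog_def)
qed

text \<open>The two inequalities say that the cokernel of \<open>D(Q') \<rightarrow> S/f^e\<close> has nonnegative dimension in each degree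
  and dimension at most that of \<open>S/(f^e, h)\<close>.\<close>
lemma hilb_Dlog_step:
  fixes f :: "'a::field_char_0 mpoly"
  assumes u: "\<And>i. i < n \<Longrightarrow> 0 < u i" and uv: "\<And>i. i < n \<Longrightarrow> u i + v i = k"
    and f: "irreducible f" "inS n f" "uhom n u c f" "1 \<le> e"
    and Q': "inS n Q'" "Q' \<noteq> 0" "uhom n u q Q'" "\<not> f dvd Q'"
  obtains b where
    "\<And>s. hilb_Dlog n u v Q' s + card (monoms n u (s - (k - c + int e * c)))
      \<le> hilb_Dlog n u v (f ^ e * Q') s + card (monoms n u (s - (k - c)))"
    "\<And>s. hilb_Dlog n u v (f ^ e * Q') s + card (monoms n u (s - (k - c + b)))
      \<le> hilb_Dlog n u v Q' s + card (monoms n u (s - (k - c + b + int e * c)))"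
proof -
  have f0: "f \<noteq> 0" "\<not> f dvd 1" using f by (auto simp: irreducible_def)
  obtain j where j: "j < n" "pdiff j f \<noteq> 0" using pdiff_nonzero[OF f(2) f0] .
  have ndvd: "\<not> f dvd pdiff j f" using not_dvd_pdiff[OF u f(3) f0(1) j] .
  have prime: "prime_in n f" using irreducible_imp_prime_in f by blast
  \<comment> \<open>For any g in S, the derivation with j-th coefficient \<open>Q' * g\<close> and
    all others 0 lies in D(Q'), and its value at \<open>f\<close> is \<open>g * h\<close>.\<close>
  define h where "h = Q' * pdiff j f"
  define b where "b = q + c - u j"
  \<comment> \<open>A derivation of degree \<open>s\<close> takes \<open>f\<close> to degree
    \<open>s - \<sigma>\<close>.\<close>
  define \<sigma> where "\<sigma> = k - c"
  define a where "a = int e * c"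
  have hS: "inS n h" unfolding h_def using Q' f inS_pdiff inS_mult by blast
  have h_hom: "uhom n u b h"
    using uhom_mult[OF Q'(3) uhom_pdiff[OF f(3) j(1)]] by (simp add: h_def b_def algebra_simps)
  have fh: "\<not> f dvd h"
    using prime_inD[OF prime] Q' ndvd inS_pdiff[OF f(2)] unfolding h_def by blast
  have h0: "h \<noteq> 0" using fh by auto
  have fe: "inS n (f ^ e)" "uhom n u a (f ^ e)" "f ^ e \<noteq> 0"
    using f f0 uhom_power[OF f(3), of e] inS_power unfolding a_def by auto
  have "hilb_Dlog n u v Q' s + card (monoms n u (s - (\<sigma> + a)))
        \<le> hilb_Dlog n u v (f ^ e * Q') s + card (monoms n u (s - \<sigma>))
      \<and> hilb_Dlog n u v (f ^ e * Q') s + card (monoms n u (s - (\<sigma> + b)))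
        \<le> hilb_Dlog n u v Q' s + card (monoms n u (s - (\<sigma> + b + a)))" for s
  proof -
    \<comment> \<open>\<open>X\<close> is the direct sum of \<open>D(Q')\<close> and \<open>S\<close>, the latter at index \<open>n\<close>, in degree \<open>s\<close>;
      \<open>\<psi>\<close> maps \<open>(\<delta>, g)\<close> to \<open>\<delta>(f) + f^e * g\<close>, so that its kernel is a copy of \<open>D(Q)\<close>.\<close>
    define dX where "dX = v(n := \<sigma> + a)"
    define X where "X = {x \<in> piece n u (Suc n) dX s. x \<in> Dlog n Q'}"
    define M :: "nat \<Rightarrow> nat \<Rightarrow> 'a mpoly" where "M = (\<lambda>_ i. if i < n then pdiff i f else f ^ e)"
    define \<psi> where "\<psi> = matmap M 1 (Suc n)"
    define \<pi> where "\<pi> = matmap (\<lambda>j i. if i = j then 1 else 0 :: 'a mpoly) n n"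
    define E where "E = matmap (\<lambda>j i. if j = n then 1 else 0 :: 'a mpoly) (Suc n) 1"
    define P1 :: "int \<Rightarrow> (nat \<Rightarrow> 'a mpoly) set" where "P1 d = piece n u 1 (\<lambda>_. d) s" for d
    have dimP1: "fv.dim (P1 d) = card (monoms n u (s - d))" "fv.finite_dim (P1 d)"
      "fv.subspace (P1 d)" for d
      unfolding P1_def using piece_dim[OF u, where ?'a = 'a] subspace_piece by auto
    have \<psi>_app: "\<psi> x = (\<lambda>i. if i = 0 then apply_der n x f + f ^ e * x n else 0)" for x
      by (auto simp: \<psi>_def matmap_apply M_def apply_der_def mult.commute fun_eq_iff)
    have \<pi>_app: "\<pi> x = (\<lambda>i. if i < n then x i else 0)" for x
      by (auto simp: \<pi>_def matmap_apply fun_eq_iff if_distrib if_distribR cong: if_cong)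
    have E_app: "E x = (\<lambda>i. if i = n then x 0 else 0)" for x
      by (auto simp: E_def matmap_apply fun_eq_iff)
    have X_sub: "X \<subseteq> piece n u (Suc n) dX s" by (auto simp: X_def)
    have X_iff: "x \<in> X \<longleftrightarrow> x \<in> Dlog n Q' \<and> (\<forall>i<n. inS n (x i) \<and> uhom n u (s - v i) (x i)) \<and>
        inS n (x n) \<and> uhom n u (s - (\<sigma> + a)) (x n) \<and> (\<forall>i>n. x i = 0)" for x
      unfolding X_def piece_def dX_def
      by (simp add: All_less_Suc Suc_le_eq) auto
    have P1_iff: "x \<in> P1 d \<longleftrightarrow> inS n (x 0) \<and> uhom n u (s - d) (x 0) \<and> (\<forall>i>0. x i = 0)" for x d
      by (simp add: P1_def piece_def Suc_le_eq)
    have Pn_iff: "x \<in> piece n u n v s \<longleftrightarrow>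
        (\<forall>i<n. inS n (x i) \<and> uhom n u (s - v i) (x i)) \<and> (\<forall>i\<ge>n. x i = 0)"
      for x :: "nat \<Rightarrow> 'a mpoly"
      by (simp add: piece_def)
    have X_Int: "X = Dlog n Q' \<inter> piece n u (Suc n) dX s" by (auto simp: X_def)
    have X: "fv.subspace X" "fv.finite_dim X"
      unfolding X_Int by (rule subspace_Dlog_piece, rule fv.finite_dim_subset[OF piece_dim(2)[OF u]]) auto
    interpret \<psi>: Vector_Spaces.linear fscale fscale \<psi> unfolding \<psi>_def by (rule linear_matmap)
    interpret \<pi>: Vector_Spaces.linear fscale fscale \<pi> unfolding \<pi>_def by (rule linear_matmap)
    interpret E: Vector_Spaces.linear fscale fscale E unfolding E_def by (rule linear_matmap)

    \<comment> \<open>\<open>\<pi>\<close> forgets the component in S. Its image D(Q') and its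
      kernel, a shifted copy of S embedded by \<open>E\<close>, give the dimension of
      \<open>X\<close>.\<close>
    have \<pi>_X: "\<pi> ` X = Dlog n Q' \<inter> piece n u n v s"
    proof (intro equalityI subsetI)
      fix y assume "y \<in> \<pi> ` X"
      then obtain x where x: "x \<in> X" "y = \<pi> x" by blast
      then have "y \<in> Dlog n Q'" using Dlog_cong[of n y x] by (auto simp: X_def \<pi>_app)
      moreover have "y \<in> piece n u n v s" using x by (simp add: X_iff Pn_iff \<pi>_app)
      ultimately show "y \<in> Dlog n Q' \<inter> piece n u n v s" by blast
    next
      fix y assume y: "y \<in> Dlog n Q' \<inter> piece n u n v s"
      have "\<pi> y = y" using y by (auto simp: \<pi>_app piece_def fun_eq_iff)
      moreover have "y \<in> X" using y by (simp add: X_iff Pn_iff)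
      ultimately show "y \<in> \<pi> ` X" by force
    qed
    have ker\<pi>: "{x \<in> X. \<pi> x = 0} = E ` P1 (\<sigma> + a)"
    proof (intro equalityI subsetI)
      fix x assume x: "x \<in> {x \<in> X. \<pi> x = 0}"
      then have x0: "x i = 0" if "i < n" for i
        using that by (auto simp: \<pi>_app fun_eq_iff dest: spec[of _ i])
      have "x = E (\<lambda>i. if i = 0 then x n else 0)"
        using x x0 by (auto simp: E_app X_iff fun_eq_iff) (metis linorder_neqE_nat)
      moreover have "(\<lambda>i. if i = 0 then x n else 0) \<in> P1 (\<sigma> + a)"
        using x by (simp add: P1_iff X_iff)
      ultimately show "x \<in> E ` P1 (\<sigma> + a)" by (rule image_eqI)
    next
      fix x assume "x \<in> E ` P1 (\<sigma> + a)"
      then obtain y where y: "y \<in> P1 (\<sigma> + a)" "x = E y" by blast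
      have "x \<in> Dlog n Q'" using Dlog_cong[of n x "\<lambda>_. 0"] Dlog_0 y by (auto simp: E_app)
      moreover have "\<pi> x = 0" using y(2) by (simp add: E_app \<pi>_app fun_eq_iff)
      ultimately show "x \<in> {x \<in> X. \<pi> x = 0}" using y by (simp add: X_iff P1_iff E_app)
    qed
    have "fv.dim (E ` P1 (\<sigma> + a)) = card (monoms n u (s - (\<sigma> + a)))"
      unfolding dimP1(1)[symmetric]
    proof (rule E.dim_image_inj[OF dimP1(3,2)])
      fix x assume x: "x \<in> P1 (\<sigma> + a)" "E x = 0"
      have "x 0 = 0" using fun_cong[OF x(2), of n] by (simp add: E_app)
      then show "x = 0" using x(1) by (auto simp: P1_iff fun_eq_iff) (metis neq0_conv)
    qed
    then have dimX: "fv.dim X = hilb_Dlog n u v Q' s + card (monoms n u (s - (\<sigma> + a)))"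
      using \<pi>.rank_nullity[OF X] unfolding \<pi>_X ker\<pi> hilb_Dlog_def by simp

    define K where "K = {x \<in> X. \<psi> x = 0}"
    have \<psi>0: "\<psi> x = 0 \<longleftrightarrow> apply_der n x f + f ^ e * x n = 0" for x
      by (auto simp: \<psi>_app fun_eq_iff)
    have K: "fv.subspace K" "fv.finite_dim K"
    proof -
      have "K = X \<inter> {x. \<psi> x = 0}" by (auto simp: K_def)
      then show "fv.subspace K" using fv.subspace_inter[OF X(1) \<psi>.subspace_kernel] by simp
      show "fv.finite_dim K" using fv.finite_dim_subset[OF X(2)] by (auto simp: K_def)
    qed
    have \<pi>_K: "\<pi> ` K = Dlog n (f ^ e * Q') \<inter> piece n u n v s"
    proof (intro equalityI subsetI)
      fix y assume "y \<in> \<pi> ` K"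
      then obtain x where x: "x \<in> X" "\<psi> x = 0" "y = \<pi> x" by (auto simp: K_def)
      have yP: "y \<in> Dlog n Q' \<inter> piece n u n v s" using \<pi>_X x by blast
      have "apply_der n y f = apply_der n x f" using x by (intro apply_der_cong) (simp add: \<pi>_app)
      then have "apply_der n y f = f ^ e * (- x n)"
        using x(2) unfolding \<psi>0 by (simp add: eq_neg_iff_add_eq_0)
      then have "f ^ e dvd apply_der n y f" by (metis dvd_triv_left)
      then show "y \<in> Dlog n (f ^ e * Q') \<inter> piece n u n v s"
        using yP Dlog_prime_power_mult[OF f(1,2,4) Q'(1,2,4)] by blast
    next
      fix y assume y: "y \<in> Dlog n (f ^ e * Q') \<inter> piece n u n v s"
      then have y': "y \<in> Dlog n Q'" "f ^ e dvd apply_der n y f"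
        using Dlog_prime_power_mult[OF f(1,2,4) Q'(1,2,4)] by blast+
      have yS: "inS n (apply_der n y f)"
        unfolding apply_der_def using y f by (intro inS_sum inS_mult inS_pdiff) (auto simp: piece_def)
      obtain z where z: "apply_der n y f = f ^ e * z" "inS n z"
        using inS_cofactor[OF y'(2) yS fe(3)] .
      have "uhom n u (s - \<sigma>) (y i * pdiff i f)" if "i < n" for i
      proof -
        have "uhom n u (s - v i + (c - u i)) (y i * pdiff i f)"
          using y that f by (intro uhom_mult uhom_pdiff) (auto simp: piece_def)
        then show ?thesis using uv[OF that] by (simp add: \<sigma>_def algebra_simps)
      qed
      then have yh: "uhom n u (s - \<sigma>) (apply_der n y f)" unfolding apply_der_def by (intro uhom_sum) auto
      \<comment> \<open>Passing to the component of the right degree makes the cofactor homogeneous;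
        the product is unchanged because it is homogeneous of degree
        \<open>s - \<sigma>\<close>.\<close>
      define z' where "z' = hcomp n u (s - \<sigma> - a) z"
      have "f ^ e * z' = hcomp n u (s - \<sigma>) (apply_der n y f)"
        unfolding z(1) z'_def hcomp_mult[OF fe(2)] ..
      then have z'1: "apply_der n y f = f ^ e * z'" using hcomp_id[OF yh] by simp
      have z'2: "inS n z'" "uhom n u (s - (\<sigma> + a)) z'"
        using inS_hcomp[OF z(2)] uhom_hcomp[of n u "s - \<sigma> - a" z] by (auto simp: z'_def algebra_simps)
      define x where "x = y(n := - z')"
      have "apply_der n x f = apply_der n y f" by (intro apply_der_cong) (simp add: x_def)
      then have "\<psi> x = 0" unfolding \<psi>0 using z'1 by (simp add: x_def)
      moreover have "x \<in> X"
        using y y'(1) z'2 Dlog_cong[of n x y]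
        by (simp add: X_iff Pn_iff x_def inS_uminus uhom_uminus)
      moreover have "\<pi> x = y" using y by (auto simp: \<pi>_app x_def piece_def fun_eq_iff)
      ultimately show "y \<in> \<pi> ` K" unfolding K_def by blast
    qed
    \<comment> \<open>On the kernel of \<open>\<psi>\<close> the derivation determines the component
      in S, since \<open>f ^ e\<close> can be cancelled.\<close>
    have "fv.dim (\<pi> ` K) = fv.dim K"
    proof (rule \<pi>.dim_image_inj[OF K])
      fix x assume x: "x \<in> K" "\<pi> x = 0"
      have x0: "x i = 0" if "i < n" for i using fun_cong[OF x(2), of i] that by (simp add: \<pi>_app)
      then have "apply_der n x f = 0" by (simp add: apply_der_def)
      then have "f ^ e * x n = 0" using x(1) by (simp add: K_def \<psi>0 del: mult_eq_0_iff)
      then have "x n = 0" using fe(3) by (metis mult_eq_0_iff)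
      then show "x = 0" using x0 x(1)
        by (auto simp: K_def X_iff fun_eq_iff) (metis linorder_neqE_nat)
    qed
    then have eq: "hilb_Dlog n u v (f ^ e * Q') s + fv.dim (\<psi> ` X)
        = hilb_Dlog n u v Q' s + card (monoms n u (s - (\<sigma> + a)))"
      using \<psi>.rank_nullity[OF X] dimX unfolding \<pi>_K K_def[symmetric] hilb_Dlog_def by simp

    have \<psi>_sub: "\<psi> ` X \<subseteq> P1 \<sigma>"
    proof
      fix y assume "y \<in> \<psi> ` X"
      then obtain x where x: "x \<in> X" "y = \<psi> x" by blast
      have "inS n (M j i) \<and> uhom n u (dX i - \<sigma>) (M j i)" if "i < Suc n" for j i
      proof (cases "i < n")
        case True
        have "uhom n u (c - u i) (pdiff i f)" using f True by (intro uhom_pdiff)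
        then show ?thesis using True f uv[OF True] by (auto simp: M_def dX_def \<sigma>_def inS_pdiff algebra_simps)
      next
        case False
        then have "i = n" using that by simp
        then show ?thesis using fe by (simp add: M_def dX_def)
      qed
      then show "y \<in> P1 \<sigma>"
        unfolding x(2) \<psi>_def P1_def by (intro matmap_piece[of _ _ _ _ _ dX]) (use x X_sub in auto)
    qed
    \<comment> \<open>Together with \<open>eq\<close> this is the first inequality; the second comes
      from a lower bound for the same image.\<close>
    then have le: "fv.dim (\<psi> ` X) \<le> card (monoms n u (s - \<sigma>))"
      using fv.dim_mono_finite_dim[OF dimP1(2)] dimP1(1) by metis

    \<comment> \<open>The image of \<open>\<phi>\<close> is the ideal \<open>(f^e, h)\<close>; \<open>G\<close> parametrises the syzygies of \<open>(f^e, h)\<close>.\<close>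
    define d2 where "d2 = (\<lambda>i::nat. if i = 0 then \<sigma> + a else \<sigma> + b)"
    define P2 :: "(nat \<Rightarrow> 'a mpoly) set" where "P2 = piece n u 2 d2 s"
    define \<phi> where "\<phi> = matmap (\<lambda>j i. if i = 0 then f ^ e else h) 1 2"
    define G where "G = matmap (\<lambda>j i. if j = 0 then - h else f ^ e) 2 1"
    interpret \<phi>: Vector_Spaces.linear fscale fscale \<phi> unfolding \<phi>_def by (rule linear_matmap)
    interpret G: Vector_Spaces.linear fscale fscale G unfolding G_def by (rule linear_matmap)
    have \<phi>_app: "\<phi> x = (\<lambda>i. if i = 0 then f ^ e * x 0 + h * x 1 else 0)" for x
      by (auto simp: \<phi>_def matmap_apply fun_eq_iff numeral_2_eq_2)
    have G_app: "G x = (\<lambda>i. if i = 0 then - (h * x 0) else if i = 1 then f ^ e * x 0 else 0)" for x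
      by (auto simp: G_def matmap_apply fun_eq_iff)
    have P2_iff: "x \<in> P2 \<longleftrightarrow> inS n (x 0) \<and> uhom n u (s - (\<sigma> + a)) (x 0) \<and>
        inS n (x 1) \<and> uhom n u (s - (\<sigma> + b)) (x 1) \<and> (\<forall>i\<ge>2. x i = 0)" for x
      unfolding P2_def piece_def d2_def numeral_2_eq_2 by (simp add: All_less_Suc) auto
    have P2: "fv.dim P2 = card (monoms n u (s - (\<sigma> + a))) + card (monoms n u (s - (\<sigma> + b)))"
      "fv.finite_dim P2" "fv.subspace P2"
      unfolding P2_def using piece_dim[OF u, where ?'a = 'a] subspace_piece
      by (auto simp: numeral_2_eq_2 d2_def)
    \<comment> \<open>\<open>f ^ e\<close> divides \<open>h * x 1\<close>, hence \<open>x 1\<close>,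
      because \<open>f\<close> is prime and does not divide \<open>h\<close>. So every syzygy is a
      multiple of the Koszul one.\<close>
    have ker\<phi>: "{x \<in> P2. \<phi> x = 0} \<subseteq> G ` P1 (\<sigma> + a + b)"
    proof
      fix x assume x: "x \<in> {x \<in> P2. \<phi> x = 0}"
      then have eq0: "f ^ e * x 0 + h * x 1 = 0" by (auto simp: \<phi>_app fun_eq_iff dest: spec[of _ 0])
      have x2: "x i = 0" if "i \<ge> 2" for i using x that by (simp add: P2_iff)
      have xs: "inS n (x 1)" "uhom n u (s - (\<sigma> + b)) (x 1)" using x by (simp_all add: P2_iff)
      have "h * x 1 = f ^ e * (- x 0)" using eq0 by (simp add: eq_neg_iff_add_eq_0 add.commute)
      then have "f ^ e dvd h * x 1" by (metis dvd_triv_left)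
      then have "f ^ e dvd x 1" using prime_in_power_dvd[OF prime f0(1) fh hS xs(1)] by blast
      then obtain z where z: "x 1 = f ^ e * z" "inS n z" using inS_cofactor[OF _ xs(1) fe(3)] by blast
      define z' where "z' = hcomp n u (s - (\<sigma> + b) - a) z"
      have "f ^ e * z' = hcomp n u (s - (\<sigma> + b)) (x 1)"
        unfolding z(1) z'_def hcomp_mult[OF fe(2)] ..
      then have z'1: "x 1 = f ^ e * z'" using hcomp_id[OF xs(2)] by simp
      have "s - (\<sigma> + b) - a = s - (\<sigma> + a + b)" by simp
      then have z'2: "inS n z'" "uhom n u (s - (\<sigma> + a + b)) z'"
        using inS_hcomp[OF z(2)] uhom_hcomp unfolding z'_def by metis+
      have "f ^ e * x 0 = f ^ e * (- (h * z'))"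
        using eq0 unfolding z'1 by (simp add: algebra_simps eq_neg_iff_add_eq_0)
      then have "x 0 = - (h * z')" using fe(3) by (metis mult_left_cancel)
      then have "x = G (\<lambda>i. if i = 0 then z' else 0)"
        using z'1 x2 by (auto simp: G_app fun_eq_iff)
      moreover have "(\<lambda>i. if i = 0 then z' else 0) \<in> P1 (\<sigma> + a + b)"
        using z'2 by (simp add: P1_iff)
      ultimately show "x \<in> G ` P1 (\<sigma> + a + b)" by (rule image_eqI)
    qed
    have "fv.dim (G ` P1 (\<sigma> + a + b)) = card (monoms n u (s - (\<sigma> + a + b)))"
      unfolding dimP1(1)[symmetric]
    proof (rule G.dim_image_inj[OF dimP1(3,2)])
      fix x assume x: "x \<in> P1 (\<sigma> + a + b)" "G x = 0"
      have "f ^ e * x 0 = 0" using fun_cong[OF x(2), of 1] by (simp add: G_app del: mult_eq_0_iff)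
      then have "x 0 = 0" using fe(3) by (metis mult_eq_0_iff)
      then show "x = 0" using x(1) by (auto simp: P1_iff fun_eq_iff) (metis neq0_conv)
    qed
    moreover have "fv.finite_dim (G ` P1 (\<sigma> + a + b))"
      using dimP1(2) unfolding fv.finite_dim_def by (meson G.spans_image finite_imageI)
    ultimately have dimker: "fv.dim {x \<in> P2. \<phi> x = 0} \<le> card (monoms n u (s - (\<sigma> + a + b)))"
      using fv.dim_mono_finite_dim[OF _ ker\<phi>] by simp
    have "\<phi> ` P2 \<subseteq> \<psi> ` X"
    proof
      fix y assume "y \<in> \<phi> ` P2"
      then obtain x where x: "x \<in> P2" "y = \<phi> x" by blast
      have xs: "inS n (x 0)" "uhom n u (s - (\<sigma> + a)) (x 0)" "inS n (x 1)" "uhom n u (s - (\<sigma> + b)) (x 1)"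
        using x(1) by (simp_all add: P2_iff)
      \<comment> \<open>The witness realizes \<open>h * x 1\<close> by a derivation along x_j and
        \<open>f ^ e * x 0\<close> by the component in S. All values of its derivation part are
        multiples of \<open>Q'\<close>, which gives membership in D(Q').\<close>
      define \<theta> where "\<theta> = (\<lambda>i. if i = j then Q' * x 1 else if i = n then x 0 else 0)"
      have "derS n \<theta>" using xs Q' by (auto simp: derS_def \<theta>_def intro: inS_mult)
      have app: "apply_der n \<theta> g = Q' * x 1 * pdiff j g" for g
      proof -
        have "apply_der n \<theta> g = (\<Sum>i<n. if i = j then Q' * x 1 * pdiff i g else 0)"
          unfolding apply_der_def by (intro sum.cong) (auto simp: \<theta>_def)
        then show ?thesis using j(1) by simp
      qed
      have "\<theta> \<in> Dlog n Q'"
        unfolding Dlog_def using \<open>derS n \<theta>\<close> by (auto simp: app)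
      moreover have "\<theta> \<in> X" if "\<theta> \<in> Dlog n Q'"
      proof -
        have "q + (s - (\<sigma> + b)) = s - v j" using uv[OF j(1)] by (simp add: \<sigma>_def b_def)
        then have "uhom n u (s - v j) (Q' * x 1)" using uhom_mult[OF Q'(3) xs(4)] by metis
        then show ?thesis
          using that xs j(1) Q' by (auto simp: X_iff \<theta>_def intro: inS_mult)
      qed
      ultimately have "\<theta> \<in> X" by blast
      moreover have "y = \<psi> \<theta>"
        unfolding x(2) \<phi>_app \<psi>_app app using j(1) by (auto simp: h_def \<theta>_def algebra_simps)
      ultimately show "y \<in> \<psi> ` X" by blast
    qed
    then have "fv.dim (\<phi> ` P2) \<le> fv.dim (\<psi> ` X)"
      using \<psi>_sub by (intro fv.dim_mono_finite_dim fv.finite_dim_subset[OF dimP1(2)])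
    then have "card (monoms n u (s - (\<sigma> + a))) + card (monoms n u (s - (\<sigma> + b)))
        \<le> fv.dim (\<psi> ` X) + card (monoms n u (s - (\<sigma> + a + b)))"
      using \<phi>.rank_nullity[OF P2(3,2)] P2(1) dimker by simp
    then have "hilb_Dlog n u v (f ^ e * Q') s + card (monoms n u (s - (\<sigma> + b)))
        \<le> hilb_Dlog n u v Q' s + card (monoms n u (s - (\<sigma> + a + b)))"
      using eq by linarith
    moreover have ab: "\<sigma> + b + a = \<sigma> + a + b" by simp
    ultimately show ?thesis unfolding ab using eq le by simp
  qed
  then show ?thesis using that[of b] unfolding \<sigma>_def a_def by blast
qed

section \<open>Hilbert function of D(Q) from a resolution\<close>

lemma mapply_hcomp:
  fixes M :: "nat \<Rightarrow> nat \<Rightarrow> 'a::comm_ring_1 mpoly"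
  assumes "\<And>i. i < r \<Longrightarrow> uhom n u (d i - d') (M j i)"
  shows "mapply M r (\<lambda>i. hcomp n u (s - d i) (b i)) j = hcomp n u (s - d') (mapply M r b j)"
  unfolding mapply_def hcomp_sum
proof (rule sum.cong[OF refl])
  fix i assume "i \<in> {..<r}"
  then have "hcomp n u (s - d') (M j i * b i) = M j i * hcomp n u (s - d' - (d i - d')) (b i)"
    using assms by (intro hcomp_mult) auto
  then show "M j i * hcomp n u (s - d i) (b i) = hcomp n u (s - d') (M j i * b i)" by simp
qed

lemma mapply_cong: "(\<And>i. i < r \<Longrightarrow> b i = c i) \<Longrightarrow> mapply M r b j = mapply M r c j"
  by (simp add: mapply_def)

text \<open>A homogeneous right-hand side that has some preimage has a homogeneous one: take
  components. This turns exactness for arbitrary vectors, as the resolution states it, into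
  exactness in each degree.\<close>

lemma matmap_onto_piece:
  fixes M :: "nat \<Rightarrow> nat \<Rightarrow> 'a::field mpoly"
  assumes M: "\<And>j i. j < t \<Longrightarrow> i < r \<Longrightarrow> uhom n u (d i - d' j) (M j i)"
    and x: "x \<in> piece n u t d' s" and b: "vecS n r b" "\<And>j. j < t \<Longrightarrow> x j = mapply M r b j"
  shows "x \<in> matmap M t r ` piece n u r d s"
proof -
  let ?b = "\<lambda>i. if i < r then hcomp n u (s - d i) (b i) else 0"
  have "?b \<in> piece n u r d s"
    using b(1) by (auto simp: piece_def vecS_def inS_hcomp uhom_hcomp)
  moreover have "x = matmap M t r ?b"
  proof
    fix j
    show "x j = matmap M t r ?b j"
    proof (cases "j < t")
      case True
      have "mapply M r ?b j = mapply M r (\<lambda>i. hcomp n u (s - d i) (b i)) j" by (rule mapply_cong) simp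
      also have "\<dots> = hcomp n u (s - d' j) (mapply M r b j)" using M True by (intro mapply_hcomp)
      also have "\<dots> = x j"
        using x b(2)[OF True] True by (metis (no_types, lifting) hcomp_id mem_Collect_eq piece_def)
      finally show ?thesis using True by (simp add: matmap_def)
    next
      case False
      then show ?thesis using x by (simp add: piece_def matmap_def)
    qed
  qed
  ultimately show ?thesis by blast
qed

text \<open>To be read with \<open>D p\<close> the dimension of the p-th module and
  \<open>E p\<close> the rank of the map leaving it, in a fixed degree.\<close>

lemma alternating_sum_telescope:
  fixes D E :: "nat \<Rightarrow> nat"
  assumes "\<And>p. p < l \<Longrightarrow> D p = E p + E (Suc p)" "m \<le> l"
  shows "(\<Sum>p<m. (-1) ^ p * int (D p)) = int (E 0) - (-1) ^ m * int (E m)"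
  using assms(2) by (induction m) (simp_all add: assms(1) algebra_simps)

text \<open>Taking degree \<open>s\<close> parts of the resolution gives an exact sequence of
  finite-dimensional spaces, whose Euler characteristic vanishes.\<close>

lemma hilb_Dlog_resolution:
  fixes Q :: "'a::field mpoly"
  assumes u: "\<And>i. i < n \<Longrightarrow> 0 < u i" and res: "homog_free_resolution n u v Q l r d M"
  shows "int (hilb_Dlog n u v Q s)
    = (\<Sum>p\<le>l. (-1) ^ p * (\<Sum>i<r p. int (card (monoms n u (s - d p i)))))"
proof -
  define tgt where "tgt = (\<lambda>p. if p = 0 then n else r (p - 1))"
  define d' where "d' p = (if p = 0 then v else d (p - 1))" for p
  note R = res[unfolded homog_free_resolution_def Let_def]
  have d'_app: "d' p j = (if p = 0 then v j else d (p - 1) j)" for p j by (simp add: d'_def)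
  have M: "inS n (M p j i)" "uhom n u (d p i - d' p j) (M p j i)"
    if "p \<le> l" "j < tgt p" "i < r p" for p j i
    using R[THEN conjunct1, rule_format, OF that(1) that(2)[unfolded tgt_def] that(3)]
    unfolding d'_app by blast+
  have into: "(\<lambda>k. M 0 k i) \<in> Dlog n Q" if "i < r 0" for i
    using R[THEN conjunct2, THEN conjunct1] that by blast
  have onto: "\<exists>c. vecS n (r 0) c \<and> (\<forall>k<n. a k = mapply (M 0) (r 0) c k)" if "a \<in> Dlog n Q" for a
    using R[THEN conjunct2, THEN conjunct2, THEN conjunct1] that by blast
  have cplx: "mapply (M p) (r p) (mapply (M (Suc p)) (r (Suc p)) b) j = 0"
    if "p < l" "vecS n (r (Suc p)) b" "j < tgt p" for p b j
    using R[THEN conjunct2, THEN conjunct2, THEN conjunct2, THEN conjunct1] that unfolding tgt_def by blast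
  have exact: "\<exists>b. vecS n (r (Suc p)) b \<and> (\<forall>i<r p. c i = mapply (M (Suc p)) (r (Suc p)) b i)"
    if "p < l" "vecS n (r p) c" "\<forall>j<tgt p. mapply (M p) (r p) c j = 0" for p c
    using R[THEN conjunct2, THEN conjunct2, THEN conjunct2, THEN conjunct1] that unfolding tgt_def by blast
  have inj: "\<forall>i<r l. c i = 0"
    if "vecS n (r l) c" "\<forall>j<tgt l. mapply (M l) (r l) c j = 0" for c
    using R[THEN conjunct2, THEN conjunct2, THEN conjunct2, THEN conjunct2] that unfolding tgt_def by blast
  define F where "F p = (piece n u (r p) (d p) s :: (nat \<Rightarrow> 'a mpoly) set)" for p
  define \<phi> where "\<phi> p = matmap (M p) (tgt p) (r p)" for p
  have FvecS: "vecS n (r p) c" if "c \<in> F p" for p c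
    using that by (auto simp: F_def piece_def vecS_def)
  have \<phi>0: "\<phi> p c = 0 \<longleftrightarrow> (\<forall>j<tgt p. mapply (M p) (r p) c j = 0)" for p c
    by (auto simp: \<phi>_def matmap_def fun_eq_iff)
  have dimF: "fv.dim (F p) = (\<Sum>i<r p. card (monoms n u (s - d p i)))" "fv.finite_dim (F p)"
    "fv.subspace (F p)" for p
    unfolding F_def using piece_dim[OF u, where ?'a = 'a] subspace_piece by auto
  have rank: "fv.dim (F p) = fv.dim (\<phi> p ` F p) + fv.dim {x \<in> F p. \<phi> p x = 0}" for p
    unfolding \<phi>_def by (rule linear.rank_nullity[OF linear_matmap dimF(3,2)])
  have ker: "{x \<in> F p. \<phi> p x = 0} = \<phi> (Suc p) ` F (Suc p)" if p: "p < l" for p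
  proof (intro equalityI subsetI)
    fix x assume x: "x \<in> {x \<in> F p. \<phi> p x = 0}"
    then obtain b where b: "vecS n (r (Suc p)) b" "\<forall>i<r p. x i = mapply (M (Suc p)) (r (Suc p)) b i"
      using exact[OF p FvecS] \<phi>0 by blast
    show "x \<in> \<phi> (Suc p) ` F (Suc p)"
      unfolding \<phi>_def F_def
    proof (rule matmap_onto_piece[OF _ _ b(1), where d' = "d p"])
      show "uhom n u (d (Suc p) i - d p j) (M (Suc p) j i)" if "j < tgt (Suc p)" "i < r (Suc p)" for j i
        using M(2)[of "Suc p" j i] p that by (simp add: d'_def)
      show "x \<in> piece n u (tgt (Suc p)) (d p) s" using x by (simp add: F_def tgt_def)
      show "x j = mapply (M (Suc p)) (r (Suc p)) b j" if "j < tgt (Suc p)" for j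
        using b that by (simp add: tgt_def)
    qed
  next
    fix x assume "x \<in> \<phi> (Suc p) ` F (Suc p)"
    then obtain b where b: "b \<in> F (Suc p)" "x = \<phi> (Suc p) b" by blast
    have "x \<in> piece n u (tgt (Suc p)) (d' (Suc p)) s"
      unfolding b(2) \<phi>_def using b(1) M p by (intro matmap_piece[of _ _ _ _ _ "d (Suc p)"]) (auto simp: F_def)
    then have "x \<in> F p" by (simp add: F_def tgt_def d'_def)
    moreover have "mapply (M p) (r p) x j = 0" if "j < tgt p" for j
    proof -
      have "mapply (M p) (r p) x j = mapply (M p) (r p) (mapply (M (Suc p)) (r (Suc p)) b) j"
        unfolding b(2) by (rule mapply_cong) (simp add: \<phi>_def matmap_def tgt_def)
      then show ?thesis using cplx[OF p FvecS[OF b(1)] that] by simp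
    qed
    ultimately show "x \<in> {x \<in> F p. \<phi> p x = 0}" using \<phi>0 by blast
  qed
  \<comment> \<open>Injectivity of the last map identifies the boundary term of the telescoping sum
    with the dimension of \<open>F l\<close>, so that the term for p = l absorbs it.\<close>
  have "{x \<in> F l. \<phi> l x = 0} = {0}"
  proof (intro equalityI subsetI)
    fix x assume x: "x \<in> {x \<in> F l. \<phi> l x = 0}"
    then have "\<forall>i<r l. x i = 0" using inj[OF FvecS] \<phi>0 by blast
    moreover have "\<forall>i\<ge>r l. x i = 0" using x by (auto simp: F_def piece_def)
    ultimately show "x \<in> {0}" by (auto simp: fun_eq_iff) (metis not_less)
  next
    fix x :: "nat \<Rightarrow> 'a mpoly" assume "x \<in> {0}"
    then show "x \<in> {x \<in> F l. \<phi> l x = 0}"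
      using fv.subspace_0[OF dimF(3)] by (auto simp: \<phi>0 mapply_def)
  qed
  moreover have "fv.dim {0 :: nat \<Rightarrow> 'a mpoly} = 0"
    by (rule fv.dim_unique[of "{}"]) (use fv.independent_empty in auto)
  ultimately have last: "fv.dim (F l) = fv.dim (\<phi> l ` F l)" using rank[of l] by simp
  have alt: "(\<Sum>p<l. (-1) ^ p * int (fv.dim (F p)))
      = int (fv.dim (\<phi> 0 ` F 0)) - (-1) ^ l * int (fv.dim (\<phi> l ` F l))"
  proof (rule alternating_sum_telescope[of l])
    fix p assume "p < l"
    from ker[OF this] show "fv.dim (F p) = fv.dim (\<phi> p ` F p) + fv.dim (\<phi> (Suc p) ` F (Suc p))"
      using rank[of p] by simp
  qed simp
  have "\<phi> 0 ` F 0 = Dlog n Q \<inter> piece n u n v s"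
  proof (intro equalityI subsetI)
    fix x assume "x \<in> \<phi> 0 ` F 0"
    then obtain c where c: "c \<in> F 0" "x = \<phi> 0 c" by blast
    have "x \<in> piece n u (tgt 0) (d' 0) s"
      unfolding c(2) \<phi>_def using c(1) M by (intro matmap_piece[of _ _ _ _ _ "d 0"]) (auto simp: F_def)
    moreover have "(\<lambda>k. \<Sum>i<r 0. c i * M 0 k i) \<in> Dlog n Q"
      using into FvecS[OF c(1)] by (intro Dlog_sum Dlog_mult) (auto simp: vecS_def)
    then have "x \<in> Dlog n Q"
      using Dlog_cong[of n x "\<lambda>k. \<Sum>i<r 0. c i * M 0 k i" Q]
      by (auto simp: c(2) \<phi>_def matmap_apply tgt_def mult.commute)
    ultimately show "x \<in> Dlog n Q \<inter> piece n u n v s" by (simp add: tgt_def d'_def)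
  next
    fix x assume x: "x \<in> Dlog n Q \<inter> piece n u n v s"
    then obtain c where c: "vecS n (r 0) c" "\<forall>k<n. x k = mapply (M 0) (r 0) c k" using onto by blast
    show "x \<in> \<phi> 0 ` F 0"
      unfolding \<phi>_def F_def
      by (rule matmap_onto_piece[OF _ _ c(1), where d' = v])
        (use x c(2) M(2)[of 0] in \<open>auto simp: tgt_def d'_def\<close>)
  qed
  then have "int (hilb_Dlog n u v Q s) = int (fv.dim (\<phi> 0 ` F 0))" by (simp add: hilb_Dlog_def)
  also have "\<dots> = (\<Sum>p<Suc l. (-1) ^ p * int (fv.dim (F p)))" using alt last by simp
  also have "\<dots> = (\<Sum>p\<le>l. (-1) ^ p * (\<Sum>i<r p. int (card (monoms n u (s - d p i)))))"
    unfolding lessThan_Suc_atMost dimF(1) by simp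
  finally show ?thesis .
qed

section \<open>Hilbert series near 1\<close>

lemma summable_power_times_geometric:
  fixes t :: real
  assumes "0 < t" "t < 1"
  shows "summable (\<lambda>k. (real k + 1) ^ n * t ^ k)"
proof -
  \<comment> \<open>\<open>t\<close> is split into n + 1 equal factors: each of the \<open>n\<close>
    factors k + 1 is tamed by its own \<open>r ^ k\<close>, and one geometric factor is left for
    convergence.\<close>
  define r where "r = root (Suc n) t"
  have r: "0 < r" "r < 1" "r ^ Suc n = t"
    using assms by (auto simp: r_def real_root_pow_pos2 simp del: power_Suc)
  have "(\<lambda>k. of_nat k * r ^ k) \<longlonglongrightarrow> 0" using r by (intro powser_times_n_limit_0) auto
  moreover have "(\<lambda>k. r ^ k) \<longlonglongrightarrow> 0" using r by (intro LIMSEQ_realpow_zero) auto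
  ultimately have "(\<lambda>k. of_nat k * r ^ k + r ^ k) \<longlonglongrightarrow> 0 + 0" by (rule tendsto_add)
  then have "Bseq (\<lambda>k. (real k + 1) * r ^ k)" by (intro convergent_imp_Bseq convergentI[of _ 0]) (simp add: algebra_simps)
  then obtain C where C: "\<And>k. norm ((real k + 1) * r ^ k) \<le> C" by (auto simp: Bseq_def)
  have "summable (\<lambda>k. C ^ n * r ^ k)" using r by (intro summable_mult summable_geometric) auto
  then show ?thesis
  proof (rule summable_comparison_test_ev[rotated], intro eventuallyI always_eventually allI)
    fix k
    have "(real k + 1) ^ n * t ^ k = ((real k + 1) * r ^ k) ^ n * r ^ k"
      by (simp add: r(3)[symmetric] power_mult_distrib power_mult[symmetric] power_add[symmetric] mult.commute mult.left_commute)
    also have "\<dots> \<le> C ^ n * r ^ k"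
      using C[of k] r by (intro mult_right_mono power_mono) auto
    finally show "norm ((real k + 1) ^ n * t ^ k) \<le> C ^ n * r ^ k"
      using assms by simp
  qed
qed

text \<open>Summation over all integers turns a degree shift, possibly negative, into a mere
  reindexing.\<close>

definition hilb_series :: "nat \<Rightarrow> (nat \<Rightarrow> int) \<Rightarrow> real \<Rightarrow> real" where
  "hilb_series n u t = (\<Sum>\<^sub>\<infinity>s::int. real (card (monoms n u s)) * t powi s)"

lemma has_sum_hilb_series:
  assumes u: "\<And>i. i < n \<Longrightarrow> 0 < u i" and t: "0 < t" "t < 1"
  shows "((\<lambda>s::int. real (card (monoms n u s)) * t powi s) has_sum hilb_series n u t) UNIV"
proof -
  have "summable (\<lambda>k. real (card (monoms n u (int k))) * t ^ k)"
  proof (rule summable_comparison_test_ev[OF _ summable_power_times_geometric[OF t, of n]], intro always_eventually allI)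
    fix k
    have "card (monoms n u (int k)) \<le> (nat (int k) + 1) ^ n" by (intro card_monoms(2) u)
    then have "real (card (monoms n u (int k))) \<le> real ((nat (int k) + 1) ^ n)"
      by (simp only: of_nat_le_iff)
    then show "norm (real (card (monoms n u (int k))) * t ^ k) \<le> (real k + 1) ^ n * t ^ k"
      using t by (simp add: abs_mult add.commute mult_right_mono)
  qed
  then have "(\<lambda>k::nat. real (card (monoms n u (int k))) * t ^ k) summable_on UNIV"
    using t by (intro summable_nonneg_imp_summable_on) auto
  then have "((\<lambda>s::int. real (card (monoms n u s)) * t powi s) \<circ> int) summable_on UNIV"
    by (simp add: o_def)
  then have "(\<lambda>s::int. real (card (monoms n u s)) * t powi s) summable_on range int"
    by (subst summable_on_reindex) auto
  then have "(\<lambda>s::int. real (card (monoms n u s)) * t powi s) summable_on UNIV"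
  proof (subst summable_on_cong_neutral[where T = "range int"])
    fix s :: int assume "s \<in> UNIV - range int"
    then have "s < 0" by (metis DiffD2 nonneg_int_cases not_less rangeI)
    then show "real (card (monoms n u s)) * t powi s = 0" using monoms_neg u by simp
  qed auto
  then show ?thesis unfolding hilb_series_def by (rule has_sum_infsum)
qed

lemma hilb_series_pos:
  assumes u: "\<And>i. i < n \<Longrightarrow> 0 < u i" and t: "0 < t" "t < 1"
  shows "0 < hilb_series n u t"
proof -
  have "0 \<in> monoms n u 0" by (simp add: monoms_def)
  then have 1: "0 < card (monoms n u 0)" using card_monoms(1)[of n u] u by (metis card_gt_0_iff empty_iff)
  have "((\<lambda>s::int. real (card (monoms n u s)) * t powi s) has_sum real (card (monoms n u 0))) {0}"
    using has_sum_finite[of "{0::int}" "\<lambda>s. real (card (monoms n u s)) * t powi s"] by simp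
  moreover have "((\<lambda>s::int. real (card (monoms n u s)) * t powi s) has_sum hilb_series n u t) UNIV"
    by (intro has_sum_hilb_series u t)
  ultimately have "real (card (monoms n u 0)) \<le> hilb_series n u t"
    by (rule has_sum_mono_neutral) (use t in auto)
  then show ?thesis using 1 by linarith
qed

lemma has_sum_hilb_shift:
  assumes u: "\<And>i. i < n \<Longrightarrow> 0 < u i" and t: "0 < t" "t < 1"
  shows "((\<lambda>s::int. real (card (monoms n u (s - d))) * t powi s) has_sum t powi d * hilb_series n u t) UNIV"
proof -
  let ?f = "\<lambda>s::int. real (card (monoms n u (s - d))) * t powi s"
  have "(?f \<circ> (\<lambda>s. s + d)) = (\<lambda>s. t powi d * (real (card (monoms n u s)) * t powi s))"
    using t by (auto simp: fun_eq_iff power_int_add)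
  then have "(?f \<circ> (\<lambda>s. s + d) has_sum t powi d * hilb_series n u t) UNIV"
    using has_sum_cmult_right[OF has_sum_hilb_series[of n u t], of "t powi d"] u t by simp
  then have "(?f has_sum t powi d * hilb_series n u t) (range (\<lambda>s. s + d))"
    by (subst has_sum_reindex) auto
  moreover have "range (\<lambda>s. s + d) = UNIV"
    by (rule surjI[of _ "\<lambda>s. s - d"]) simp
  ultimately show ?thesis by simp
qed

text \<open>The limit is the derivative at 1 and does not depend on \<open>d\<close>; hence the
  shifts \<open>\<sigma>\<close> and \<open>\<sigma> + b\<close> in the two bounds lead to the same
  value.\<close>

lemma tendsto_powi_quotient:
  "((\<lambda>t::real. (t powi (d + a) - t powi d) / (t - 1)) \<longlongrightarrow> of_int a) (at_left 1)"
proof -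
  have "((\<lambda>t. t powi (d + a) - t powi d) has_real_derivative of_int (d + a) - of_int d) (at 1)"
    by (auto intro!: derivative_eq_intros)
  then have "((\<lambda>t::real. (t powi (d + a) - t powi d) / (t - 1)) \<longlongrightarrow> of_int a) (at 1)"
    by (simp add: has_field_derivative_iff)
  then show ?thesis by (rule filterlim_mono) (auto simp: at_le)
qed

lemma eventually_at_left_1: "eventually (\<lambda>t::real. 0 < t \<and> t < 1) (at_left 1)"
  by (rule eventually_at_leftI[of 0]) auto

lemma has_sum_sum:
  fixes f :: "'i \<Rightarrow> 'b \<Rightarrow> real"
  assumes "\<And>i. i \<in> I \<Longrightarrow> (f i has_sum S i) A"
  shows "((\<lambda>x. \<Sum>i\<in>I. f i x) has_sum (\<Sum>i\<in>I. S i)) A"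
  using assms by (induction I rule: infinite_finite_induct) (simp_all add: has_sum_add)

lemma add_mult_le_imp_divide_add_le:
  fixes A B p q Z :: real
  assumes "A + p * Z \<le> B + q * Z" "0 < Z" shows "A / Z + p \<le> B / Z + q"
  using assms divide_right_mono[OF assms(1), of Z] by (simp add: add_divide_distrib)

text \<open>The quotient of the series behaves near 1 as a function with value \<open>n\<close> and
  slope |v| + q. The induction removes the full power of one irreducible factor, so that the
  cofactor is prime to it.\<close>

lemma hilb_Dlog_asymptotics:
  fixes Q :: "'a::field_char_0 mpoly"
  assumes u: "\<And>i. i < n \<Longrightarrow> 0 < u i" and uv: "\<And>i. i < n \<Longrightarrow> u i + v i = k"
    and Q: "inS n Q" "Q \<noteq> 0" "uhom n u q Q"
  shows "((\<lambda>t. ((\<Sum>\<^sub>\<infinity>s. real (hilb_Dlog n u v Q s) * t powi s) / hilb_series n u t - real n) / (t - 1))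
    \<longlongrightarrow> of_int ((\<Sum>i<n. v i) + q)) (at_left 1)"
  using Q
proof (induction "nat q" arbitrary: Q q rule: less_induct)
  case less
  let ?N = "\<lambda>Q t. \<Sum>\<^sub>\<infinity>s. real (hilb_Dlog n u v Q s) * t powi s"
  let ?Z = "hilb_series n u"
  have shift: "((\<lambda>s. real (card (monoms n u (s - d))) * t powi s) has_sum t powi d * ?Z t) UNIV"
    if "0 < t" "t < 1" for d t
    by (intro has_sum_hilb_shift u that)
  have Z_pos: "0 < ?Z t" if "0 < t" "t < 1" for t by (intro hilb_series_pos u that)
  have wQ: "wtop n u Q = q" using wtop_uhom less.prems by blast
  show ?case
  proof (cases "Q dvd 1")
    case True
    then have q: "q = 0" using wtop_unit wQ by blast
    have "?N Q t = (\<Sum>i<n. t powi v i) * ?Z t" if t: "0 < t" "t < 1" for t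
    proof (rule infsumI)
      have "((\<lambda>s. \<Sum>i<n. real (card (monoms n u (s - v i))) * t powi s) has_sum (\<Sum>i<n. t powi v i * ?Z t)) UNIV"
        by (intro has_sum_sum shift t)
      then show "((\<lambda>s. real (hilb_Dlog n u v Q s) * t powi s) has_sum (\<Sum>i<n. t powi v i) * ?Z t) UNIV"
        using piece_dim(1)[of n u n v, OF u, where ?'a = 'a]
        by (simp add: hilb_Dlog_unit[OF True] sum_distrib_right)
    qed
    \<comment> \<open>Distributing \<open>n\<close> over the summands as t^0 gives \<open>n\<close>
      separate quotients to which \<open>tendsto_powi_quotient\<close> applies.\<close>
    then have "eventually (\<lambda>t. (\<Sum>i<n. (t powi (0 + v i) - t powi 0) / (t - 1)) = (?N Q t / ?Z t - real n) / (t - 1)) (at_left 1)"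
      using Z_pos
      by (intro eventually_mono[OF eventually_at_left_1])
        (auto simp: sum_divide_distrib[symmetric] sum_subtractf less_imp_neq[symmetric])
    moreover have "((\<lambda>t::real. \<Sum>i<n. (t powi (0 + v i) - t powi 0) / (t - 1)) \<longlongrightarrow> (\<Sum>i<n. of_int (v i))) (at_left 1)"
      by (intro tendsto_sum tendsto_powi_quotient)
    ultimately show ?thesis using q by (simp add: tendsto_cong)
  next
    case False
    obtain f where f: "irreducible f" "f dvd Q" "inS n f"
      using irreducible_factor_exists less.prems False by blast
    then have f0: "f \<noteq> 0" "\<not> f dvd 1" by (auto simp: irreducible_def)
    obtain c where c: "uhom n u c f" using uhom_dvd f(2) less.prems(2,3) by blast
    have cpos: "0 < c"
      using unit_if_wtop_0[of f n u] f0 f(3) u wtop_uhom[OF f0(1) c] by force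
    have bound: "int e * c \<le> q" if "f ^ e dvd Q" for e
    proof -
      obtain r where r: "Q = f ^ e * r" using \<open>f ^ e dvd Q\<close> by (rule dvdE)
      then have "r \<noteq> 0" "f ^ e \<noteq> 0" using less.prems f0 by auto
      then have "q = int e * c + wtop n u r"
        using wtop_mult[of "f ^ e" r n u] wtop_uhom[OF _ uhom_power[OF c]] r wQ by simp
      moreover have "0 \<le> wtop n u r"
        using \<open>r \<noteq> 0\<close> u by (intro wtop_nonneg) (auto simp: less_imp_le)
      ultimately show ?thesis by simp
    qed
    \<comment> \<open>The multiplicity of \<open>f\<close> in \<open>Q\<close> exists because each
      factor \<open>f\<close> uses up degree \<open>c\<close> >= 1 out of \<open>q\<close>.\<close>
    define e where "e = (GREATEST e. f ^ e dvd Q)"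
    have le: "e \<le> nat q" if "f ^ e dvd Q" for e
    proof -
      have "int e * 1 \<le> int e * c" using cpos by (intro mult_left_mono) auto
      then show ?thesis using bound[OF that] by linarith
    qed
    have fe: "f ^ e dvd Q"
      unfolding e_def by (rule GreatestI_nat[where k = 0 and b = "nat q"]) (auto intro: le)
    have fSe: "\<not> f ^ Suc e dvd Q"
      using Greatest_le_nat[of "\<lambda>e. f ^ e dvd Q" "Suc e" "nat q"] le unfolding e_def by fastforce
    have e1: "1 \<le> e" unfolding e_def using f(2) le by (intro Greatest_le_nat[where b = "nat q"]) auto
    obtain Q' where Q': "Q = f ^ e * Q'" "inS n Q'"
      using inS_cofactor[OF fe less.prems(1)] f0 by auto
    have Q'0: "Q' \<noteq> 0" using Q' less.prems by auto
    have fQ': "\<not> f dvd Q'"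
    proof
      assume "f dvd Q'"
      then have "f ^ e * f dvd f ^ e * Q'" by (rule mult_dvd_mono[OF dvd_refl])
      then show False using fSe Q' by (simp add: mult.commute)
    qed
    obtain a' where "uhom n u a' (f ^ e)" "uhom n u (q - a') Q'"
      using uhom_factor less.prems(2,3) Q'(1) by metis
    then have Q'h: "uhom n u (q - int e * c) Q'"
      using uhom_unique[of "f ^ e" n u a' "int e * c"] uhom_power[OF c] f0 by auto
    have lt: "nat (q - int e * c) < nat q"
    proof -
      have "0 < int e * c" using e1 cpos by simp
      then show ?thesis using bound[OF fe] by linarith
    qed
    define \<sigma> a where "\<sigma> = k - c" and "a = int e * c"
    obtain b where b: "\<And>s. hilb_Dlog n u v Q' s + card (monoms n u (s - (\<sigma> + a)))
          \<le> hilb_Dlog n u v Q s + card (monoms n u (s - \<sigma>))"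
        "\<And>s. hilb_Dlog n u v Q s + card (monoms n u (s - (\<sigma> + b)))
          \<le> hilb_Dlog n u v Q' s + card (monoms n u (s - (\<sigma> + b + a)))"
      using hilb_Dlog_step[OF u uv f(1,3) c e1 Q'(2) Q'0 Q'h fQ'] unfolding \<sigma>_def a_def Q'(1) by metis
    have sum: "((\<lambda>s. real (hilb_Dlog n u v Q s) * t powi s) has_sum ?N Q t) UNIV"
      if t: "0 < t" "t < 1" for Q :: "'a mpoly" and t
    proof -
      have "((\<lambda>s. \<Sum>i<n. real (card (monoms n u (s - v i))) * t powi s) has_sum (\<Sum>i<n. t powi v i * ?Z t)) UNIV"
        by (intro has_sum_sum shift t)
      then have "(\<lambda>s. \<Sum>i<n. real (card (monoms n u (s - v i))) * t powi s) summable_on UNIV"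
        by (rule has_sum_imp_summable)
      then have "(\<lambda>s. real (hilb_Dlog n u v Q s) * t powi s) summable_on UNIV"
      proof (rule summable_on_comparison_test)
        fix s
        have "real (hilb_Dlog n u v Q s) \<le> (\<Sum>i<n. real (card (monoms n u (s - v i))))"
          using hilb_Dlog_le[of n u v Q s] u by (metis of_nat_le_iff of_nat_sum)
        then show "real (hilb_Dlog n u v Q s) * t powi s \<le> (\<Sum>i<n. real (card (monoms n u (s - v i))) * t powi s)"
          using t by (simp add: sum_distrib_right[symmetric] mult_right_mono)
        show "0 \<le> real (hilb_Dlog n u v Q s) * t powi s" using t by simp
      qed
      then show ?thesis by (rule has_sum_infsum)
    qed
    let ?G = "\<lambda>Q t. (?N Q t / ?Z t - real n) / (t - 1)"
    let ?q = "\<lambda>d t. (t powi (d + a) - t powi d) / (t - 1)"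
    have ev: "?G Q' t + ?q (\<sigma> + b) t \<le> ?G Q t \<and> ?G Q t \<le> ?G Q' t + ?q \<sigma> t" if "0 < t \<and> t < 1" for t
    proof -
      have t: "0 < t" "t < 1" using that by auto
      note shift = shift[OF t]
      have Z: "0 < ?Z t" using Z_pos t by blast
      have "?N Q' t + t powi (\<sigma> + a) * ?Z t \<le> ?N Q t + t powi \<sigma> * ?Z t"
      proof (rule has_sum_mono[OF has_sum_add[OF sum[OF t] shift] has_sum_add[OF sum[OF t] shift]])
        fix s
        have "real (hilb_Dlog n u v Q' s) + real (card (monoms n u (s - (\<sigma> + a))))
            \<le> real (hilb_Dlog n u v Q s) + real (card (monoms n u (s - \<sigma>)))"
          using b(1)[of s] by linarith
        from mult_right_mono[OF this, of "t powi s"]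
        show "real (hilb_Dlog n u v Q' s) * t powi s + real (card (monoms n u (s - (\<sigma> + a)))) * t powi s
            \<le> real (hilb_Dlog n u v Q s) * t powi s + real (card (monoms n u (s - \<sigma>))) * t powi s"
          using t by (simp add: distrib_right)
      qed
      from add_mult_le_imp_divide_add_le[OF this Z]
      have "(?N Q t / ?Z t - real n) \<ge> (?N Q' t / ?Z t - real n) + (t powi (\<sigma> + a) - t powi \<sigma>)" by simp
      \<comment> \<open>Since t - 1 < 0, a lower bound for the series becomes an upper bound for the
        quotient.\<close>
      from divide_right_mono_neg[OF this, of "t - 1"]
      have 1: "?G Q t \<le> ?G Q' t + ?q \<sigma> t" using t by (simp add: add_divide_distrib)
      have "?N Q t + t powi (\<sigma> + b) * ?Z t \<le> ?N Q' t + t powi (\<sigma> + b + a) * ?Z t"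
      proof (rule has_sum_mono[OF has_sum_add[OF sum[OF t] shift] has_sum_add[OF sum[OF t] shift]])
        fix s
        have "real (hilb_Dlog n u v Q s) + real (card (monoms n u (s - (\<sigma> + b))))
            \<le> real (hilb_Dlog n u v Q' s) + real (card (monoms n u (s - (\<sigma> + b + a))))"
          using b(2)[of s] by linarith
        from mult_right_mono[OF this, of "t powi s"]
        show "real (hilb_Dlog n u v Q s) * t powi s + real (card (monoms n u (s - (\<sigma> + b)))) * t powi s
            \<le> real (hilb_Dlog n u v Q' s) * t powi s + real (card (monoms n u (s - (\<sigma> + b + a)))) * t powi s"
          using t by (simp add: distrib_right)
      qed
      from add_mult_le_imp_divide_add_le[OF this Z]
      have "(?N Q t / ?Z t - real n) \<le> (?N Q' t / ?Z t - real n) + (t powi (\<sigma> + b + a) - t powi (\<sigma> + b))"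
        by simp
      from divide_right_mono_neg[OF this, of "t - 1"]
      have "?G Q' t + ?q (\<sigma> + b) t \<le> ?G Q t" using t by (simp add: add_divide_distrib)
      then show ?thesis using 1 by simp
    qed
    have IH: "(?G Q' \<longlongrightarrow> of_int ((\<Sum>i<n. v i) + (q - int e * c))) (at_left 1)"
      using less.hyps[OF lt Q'(2) Q'0 Q'h] .
    have sum_q: "((\<Sum>i<n. v i) + (q - int e * c)) + a = (\<Sum>i<n. v i) + q" by (simp add: a_def)
    have lim: "((\<lambda>t. ?G Q' t + ?q d t) \<longlongrightarrow> of_int ((\<Sum>i<n. v i) + q)) (at_left 1)" for d
      using tendsto_add[OF IH tendsto_powi_quotient[of d a]] unfolding of_int_add[symmetric] sum_q .
    show ?thesis
      by (rule tendsto_sandwich[OF _ _ lim[of "\<sigma> + b"] lim[of \<sigma>]])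
        (use ev in \<open>auto intro: eventually_mono[OF eventually_at_left_1]\<close>)
  qed
qed

section \<open>Comparison of the two expansions at 1\<close>

theorem mainTheorem1:
  fixes n :: nat and u v :: "nat \<Rightarrow> int" and k dQ :: int
    and Q :: "('a::field_char_0) mpoly"
  assumes u_pos: "\<forall>i<n. u i > 0"
    and uv: "\<forall>i<n. u i + v i = k"
    and Q_S: "inS n Q" and Q_nz: "Q \<noteq> 0" and Q_hom: "uhom n u dQ Q"
  shows "(\<forall>a\<in>Dlog n Q. \<forall>t. hcompD n u v t a \<in> Dlog n Q)
     \<and> (\<forall>l r d M. homog_free_resolution n u v Q l r d M \<longrightarrow>
          dQ + (\<Sum>i<n. v i) = (\<Sum>p\<le>l. (-1) ^ p * (\<Sum>i<r p. d p i)))"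
proof (intro conjI ballI allI impI)
  fix a t assume "a \<in> Dlog n Q"
  then show "hcompD n u v t a \<in> Dlog n Q"
    using uv Q_nz Q_hom by (intro hcompD_Dlog[of n u v k]) auto
next
  fix l r d M assume res: "homog_free_resolution n u v Q l r d M"
  let ?Z = "hilb_series n u"
  \<comment> \<open>By the resolution the series of D(Q) is \<open>P t\<close> times that of S. As a
    Laurent polynomial, \<open>P\<close> is differentiable at 1.\<close>
  define P :: "real \<Rightarrow> real" where "P t = (\<Sum>p\<le>l. (-1) ^ p * (\<Sum>i<r p. t powi d p i))" for t
  have series: "(\<Sum>\<^sub>\<infinity>s. real (hilb_Dlog n u v Q s) * t powi s) / ?Z t = P t" if t: "0 < t" "t < 1" for t
  proof -
    have "((\<lambda>s. \<Sum>p\<le>l. (-1) ^ p * (\<Sum>i<r p. real (card (monoms n u (s - d p i))) * t powi s))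
        has_sum (\<Sum>p\<le>l. (-1) ^ p * (\<Sum>i<r p. t powi d p i * ?Z t))) UNIV"
      using u_pos t by (intro has_sum_sum has_sum_cmult_right has_sum_hilb_shift) auto
    also have "(\<lambda>s. \<Sum>p\<le>l. (-1) ^ p * (\<Sum>i<r p. real (card (monoms n u (s - d p i))) * t powi s))
        = (\<lambda>s. real (hilb_Dlog n u v Q s) * t powi s)"
    proof
      fix s
      have "real (hilb_Dlog n u v Q s) = real_of_int (int (hilb_Dlog n u v Q s))" by simp
      also have "\<dots> = (\<Sum>p\<le>l. (-1) ^ p * (\<Sum>i<r p. real (card (monoms n u (s - d p i)))))"
        using u_pos by (subst hilb_Dlog_resolution[OF _ res]) auto
      finally show "(\<Sum>p\<le>l. (-1) ^ p * (\<Sum>i<r p. real (card (monoms n u (s - d p i))) * t powi s))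
          = real (hilb_Dlog n u v Q s) * t powi s"
        by (simp add: sum_distrib_right mult.assoc)
    qed
    also have "(\<Sum>p\<le>l. (-1) ^ p * (\<Sum>i<r p. t powi d p i * ?Z t)) = P t * ?Z t"
      by (simp add: P_def sum_distrib_right mult.assoc)
    finally have "(\<Sum>\<^sub>\<infinity>s. real (hilb_Dlog n u v Q s) * t powi s) = P t * ?Z t" by (rule infsumI)
    moreover have "0 < ?Z t" using u_pos t by (intro hilb_series_pos) auto
    ultimately show ?thesis by simp
  qed
  have lim: "((\<lambda>t. (P t - real n) / (t - 1)) \<longlongrightarrow> of_int ((\<Sum>i<n. v i) + dQ)) (at_left 1)"
  proof (rule Lim_transform_eventually)
    show "((\<lambda>t. ((\<Sum>\<^sub>\<infinity>s. real (hilb_Dlog n u v Q s) * t powi s) / ?Z t - real n) / (t - 1))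
        \<longlongrightarrow> of_int ((\<Sum>i<n. v i) + dQ)) (at_left 1)"
      using u_pos uv Q_S Q_nz Q_hom by (intro hilb_Dlog_asymptotics[of n u v k]) auto
    show "eventually (\<lambda>t. ((\<Sum>\<^sub>\<infinity>s. real (hilb_Dlog n u v Q s) * t powi s) / ?Z t - real n) / (t - 1)
        = (P t - real n) / (t - 1)) (at_left 1)"
      using series by (intro eventually_mono[OF eventually_at_left_1]) auto
  qed
  have deriv: "(P has_real_derivative (\<Sum>p\<le>l. (-1) ^ p * (\<Sum>i<r p. of_int (d p i)))) (at 1)"
    unfolding P_def by (auto intro!: derivative_eq_intros simp: mult.commute)
  \<comment> \<open>A finite limit of the quotient forces its numerator to tend to 0, so the
    alternating sum of the ranks, which is \<open>P 1\<close>, equals \<open>n\<close>.\<close>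
  have P1: "P 1 = real n"
  proof -
    have "((\<lambda>t. (P t - real n) / (t - 1) * (t - 1)) \<longlongrightarrow> of_int ((\<Sum>i<n. v i) + dQ) * (1 - 1)) (at_left 1)"
      by (intro tendsto_intros lim)
    moreover have "eventually (\<lambda>t. (P t - real n) / (t - 1) * (t - 1) = P t - real n) (at_left 1)"
      by (rule eventually_mono[OF eventually_at_left_1]) auto
    ultimately have "((\<lambda>t. P t - real n) \<longlongrightarrow> of_int ((\<Sum>i<n. v i) + dQ) * (1 - 1)) (at_left 1)"
      by (rule Lim_transform_eventually)
    then have "((\<lambda>t. P t - real n) \<longlongrightarrow> 0) (at_left 1)" by simp
    moreover have "(P \<longlongrightarrow> P 1) (at_left 1)"
      using DERIV_isCont[OF deriv] by (auto simp: isCont_def intro: tendsto_within_subset)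
    then have "((\<lambda>t. P t - real n) \<longlongrightarrow> P 1 - real n) (at_left 1)" by (intro tendsto_intros)
    ultimately have "P 1 - real n = 0" by (intro tendsto_unique[of "at_left 1"]) auto
    then show ?thesis by simp
  qed
  \<comment> \<open>Since \<open>P 1\<close> is \<open>n\<close>, the quotient in \<open>lim\<close>
    is the difference quotient of \<open>P\<close>; uniqueness of limits then compares the two
    slopes.\<close>
  have "((\<lambda>t. (P t - real n) / (t - 1)) \<longlongrightarrow> (\<Sum>p\<le>l. (-1) ^ p * (\<Sum>i<r p. of_int (d p i)))) (at_left 1)"
    using deriv unfolding has_field_derivative_iff P1 by (rule tendsto_within_subset) auto
  then have "of_int ((\<Sum>i<n. v i) + dQ) = (\<Sum>p\<le>l. (-1) ^ p * (\<Sum>i<r p. real_of_int (d p i)))"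
    using lim by (intro tendsto_unique[of "at_left 1"]) auto
  also have "\<dots> = of_int (\<Sum>p\<le>l. (-1) ^ p * (\<Sum>i<r p. d p i))" by simp
  finally show "dQ + (\<Sum>i<n. v i) = (\<Sum>p\<le>l. (-1) ^ p * (\<Sum>i<r p. d p i))"
    unfolding of_int_eq_iff by simp
qed

end
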